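(* Let $M_0\in\mathbb R^{p\times H}$ ($p\le H$) have rank $d_0$, let $m\in\{1,\dots,p\}$, and consider the hypotheses $H_0:d_0=m$ against $H_1:d_0>m$. Let $\widehat M\in\mathbb R^{p\times H}$ be an estimator of $M_0$ such that $n^{1/2}(\widehat M-M_0)$ converges in law to a random matrix $W$ with $\operatorname{vec}(W)\sim\mathcal N(0,\Gamma)$, where $\Gamma$ is full rank, and such that $\widehat M\to M_0$ almost surely. Let $\widehat\Gamma\to\Gamma$ in probability, and let $\Gamma^*\in\mathbb R^{pH\times pH}$ be such that, conditionally on the sample, almost surely, $\Gamma^*\to\Gamma$ in probability. Let $$\widehat M_c=\operatorname*{argmin}_{\operatorname{rank}(M)=m}\operatorname{vec}(\widehat M-M)^T\widehat\Gamma^{-1}\operatorname{vec}(\widehat M-M),\qquad M_0^*=\widehat M_c+n^{-1/2}W^*,$$ where, almost surely, conditionally on the sample, $W^*$ converges in law to $W$. Let $$\widehat\Lambda_3=n\min_{\operatorname{rank}(M)=m}\operatorname{vec}(\widehat M-M)^T\widehat\Gamma^{-1}\operatorname{vec}(\widehat M-M),\qquad \Lambda_3^*=n\min_{\operatorname{rank}(M)=m}\operatorname{vec}(M_0^*-M)^T\Gamma^{*-1}\operatorname{vec}(M_0^*-M).$$ Then the test which rejects $H_0$ when $\widehat\Lambda_3>\widehat q_3(\alpha)$, where $\widehat q_3(\alpha)$ is the quantile of level $\alpha$ of the law of $\Lambda_3^*$ conditionally on the sample, is consistent: for every $\alpha\in(0,1)$, $$\mathbb P_{H_0}\big(\widehat\Lambda_3>\widehat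 q_3(\alpha)\big)\to1-\alpha\qquad\text{and}\qquad\mathbb P_{H_1}\big(\widehat\Lambda_3>\widehat q_3(\alpha)\big)\to1 .$$
   Context: All limits are as the sample size $n\to\infty$; hatted quantities depend on the sample of size $n$, starred quantities depend on the sample and on additional bootstrap randomness. $\operatorname{vec}$ vectorizes a matrix by stacking its columns. Minimizations are over matrices $M\in\mathbb R^{p\times H}$ of rank $m$. $\widehat\Gamma$ and $\Gamma^*$ are estimators of the covariance matrix $\Gamma\in\mathbb R^{pH\times pH}$ (symmetric positive semi-definite). The quantile of level $\alpha$ of a law with cumulative distribution function $F$ is $\inf\{x:F(x)\ge\alpha\}$. $\mathbb P_{H_0}$ and $\mathbb P_{H_1}$ denote probability when $H_0$, respectively $H_1$, holds.
   Formalization: The limit 1−α under H0 is claimed only for m<p: if m=p=d_0, both statistics vanish with probability tending to 1, so the rejection probability tends to 0 and the claim as stated fails. *)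

theory Defs
  imports "HOL-Probability.Probability"
begin

text \<open>
  A matrix with \<open>p\<close> rows and \<open>H\<close> columns has type \<^typ>\<open>real^'h^'p\<close>. Its vectorization is indexed by
  pairs (column, row), column first, which is column stacking up to the choice of an
  enumeration of the two index types.
\<close>

definition vectorize :: "real^'h^'p \<Rightarrow> real^('h \<times> 'p)" where
  "vectorize A = (\<chi> k. A $ snd k $ fst k)"

text \<open>Lebesgue density of the normal law with mean \<open>\<mu>\<close> and nonsingular covariance matrix \<open>\<Sigma>\<close>.\<close>

definition mvn_density :: "real^'k \<Rightarrow> real^'k^'k \<Rightarrow> real^'k \<Rightarrow> real" where
  "mvn_density \<mu> \<Sigma> x =
     exp (- ((x - \<mu>) \<bullet> (matrix_inv \<Sigma> *v (x - \<mu>))) / 2) / sqrt ((2 * pi) ^ CARD('k) * det \<Sigma>)"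

definition covariance_matrix :: "real^'k^'k \<Rightarrow> bool" where
  "covariance_matrix \<Sigma> \<longleftrightarrow> transpose \<Sigma> = \<Sigma> \<and> (\<forall>x. 0 \<le> x \<bullet> (\<Sigma> *v x))"

text \<open>
  In both modes of convergence the underlying probability space \<open>P n\<close> may vary with \<open>n\<close>; for
  conditional convergence given the sample, \<open>P n\<close> is the conditional law of the bootstrap
  randomness.
\<close>

definition converges_in_law ::
    "(nat \<Rightarrow> 'a measure) \<Rightarrow> (nat \<Rightarrow> 'a \<Rightarrow> 'e::topological_space) \<Rightarrow> 'c measure \<Rightarrow> ('c \<Rightarrow> 'e) \<Rightarrow> bool" where
  "converges_in_law P X Q Y \<longleftrightarrow>
     (\<forall>f::'e \<Rightarrow> real. continuous_on UNIV f \<and> bounded (range f) \<longrightarrow>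
        (\<lambda>n. \<integral>x. f (X n x) \<partial>P n) \<longlonglongrightarrow> (\<integral>y. f (Y y) \<partial>Q))"

definition converges_in_prob ::
    "(nat \<Rightarrow> 'a measure) \<Rightarrow> (nat \<Rightarrow> 'a \<Rightarrow> 'e::metric_space) \<Rightarrow> 'e \<Rightarrow> bool" where
  "converges_in_prob P X c \<longleftrightarrow>
     (\<forall>\<epsilon>>0. (\<lambda>n. measure (P n) {x \<in> space (P n). dist (X n x) c > \<epsilon>}) \<longlonglongrightarrow> 0)"

definition quantile :: "real measure \<Rightarrow> real \<Rightarrow> real" where
  "quantile \<nu> \<alpha> = Inf {x. cdf \<nu> x \<ge> \<alpha>}"

text \<open>
  \<^const>\<open>matrix_inv\<close> is the inverse for nonsingular arguments only; its value at a singular matrix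
  is an unspecified constant.
\<close>

definition weighted_sq :: "real^('h \<times> 'p)^('h \<times> 'p) \<Rightarrow> real^'h^'p \<Rightarrow> real" where
  "weighted_sq G A = vectorize A \<bullet> (matrix_inv G *v vectorize A)"

text \<open>
  The matrices of rank exactly \<open>m\<close> do not form a closed set, so the minimum need not be attained
  (for instance if \<open>rank X < m\<close>). The infimum equals the minimum whenever the latter exists.
\<close>

definition min_rank_sq :: "nat \<Rightarrow> real^('h \<times> 'p)^('h \<times> 'p) \<Rightarrow> real^'h^'p \<Rightarrow> real" where
  "min_rank_sq m G X = (INF A\<in>{A. rank A = m}. weighted_sq G (X - A))"

definition is_rank_argmin ::
    "nat \<Rightarrow> real^('h \<times> 'p)^('h \<times> 'p) \<Rightarrow> real^'h^'p \<Rightarrow> real^'h^'p \<Rightarrow> bool" where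
  "is_rank_argmin m G X A \<longleftrightarrow> is_arg_min (\<lambda>A. weighted_sq G (X - A)) (\<lambda>A. rank A = m) A"

end

theory Submission
  imports Defs
begin

text \<open>
  Near \<open>M0\<close> the matrices of rank \<open>m\<close> form a manifold. Hence, for base points \<open>A \<rightarrow> M0\<close> of rank \<open>m\<close>,
  \<open>G \<rightarrow> \<Gamma>\<close> and \<open>t \<rightarrow> 0\<close>, the rescaled minimum \<open>t\<^sup>-\<^sup>2 min_rank_sq m G (A + t Z)\<close> converges, locally
  uniformly in \<open>Z\<close>, to the squared \<open>\<Gamma>\<close>-distance of \<open>Z\<close> to the tangent space at \<open>M0\<close>. With \<open>A = M0\<close> this
  gives the limit law of \<open>\<Lambda>hat\<close> under the null hypothesis, and with \<open>A = Mc\<close> the same conditional limit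
  law for \<open>\<Lambda>star\<close>. Convexity and homogeneity of the limit functional show that the
  limit law has no atoms and a strictly increasing distribution function on the half line, so that
  the bootstrap quantiles converge. Under the alternative \<open>\<Lambda>hat\<close> grows linearly in \<open>n\<close>, whereas \<open>qhat\<close>
  stays bounded. Only convergence in probability of \<open>\<Gamma>hat\<close> is assumed, so almost sure arguments are
  applied along subsequences.
\<close>

section \<open>Matrices and weighted squares\<close>

text \<open>The bootstrap is centred at \<open>Mc\<close>, which moves with the sample, so the local
  approximation has to hold at moving base points; all that is then asked of \<open>Mc\<close> is
  convergence to \<open>M0\<close> at constant rank, without any rate. The matrices of rank exactly
  \<open>m\<close> form a set that is neither closed nor convex in general, and the local analysis
  never parametrizes minimizers: the upper bound comes from explicit curves of constant rank, the
  lower bound from compactness of rescaled near minimizers. The approximation is deterministic and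
  uniform on bounded sets, so that tightness turns it into convergence in probability, under the law
  of the sample and under each conditional law alike. The limit law is not computed; only its
  continuity and the positivity of its mass on open intervals of the half line enter. The claims
  concern sequences of numbers, so it suffices to treat a subsequence of each subsequence.\<close>

lemma bounded_bilinear_matrix_vector_mult:
  "bounded_bilinear ((*v) :: real^'n^'m \<Rightarrow> real^'n \<Rightarrow> real^'m)"
  unfolding bilinear_conv_bounded_bilinear[symmetric] bilinear_def
  by (auto intro!: linearI simp: matrix_vector_mult_add_rdistrib matrix_vector_right_distrib
      matrix_vector_mult_scaleR scaleR_matrix_vector_assoc)

lemmas tendsto_matrix_vector_mult = bounded_bilinear.tendsto[OF bounded_bilinear_matrix_vector_mult]

lemma matrix_add_rdistrib: "(A + B) ** C = A ** C + B ** (C :: real^'k^'n)"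
  for A B :: "real^'n^'m"
  by (simp add: matrix_matrix_mult_def vec_eq_iff sum.distrib algebra_simps)

lemma matrix_matrix_mult_scaleR: "(c *\<^sub>R A) ** B = c *\<^sub>R (A ** B)" "A ** (c *\<^sub>R B) = c *\<^sub>R (A ** B)"
  for A :: "real^'n^'m" and B :: "real^'k^'n"
  by (simp_all add: matrix_matrix_mult_def vec_eq_iff sum_distrib_left algebra_simps)

lemma bounded_bilinear_matrix_matrix_mult:
  "bounded_bilinear ((**) :: real^'n^'m \<Rightarrow> real^'k^'n \<Rightarrow> real^'k^'m)"
  unfolding bilinear_conv_bounded_bilinear[symmetric] bilinear_def
  by (auto intro!: linearI simp: matrix_add_rdistrib matrix_add_ldistrib
      matrix_matrix_mult_scaleR)

lemmas tendsto_matrix_matrix_mult = bounded_bilinear.tendsto[OF bounded_bilinear_matrix_matrix_mult]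

section \<open>Continuity and Borel measurability of the matrix inverse\<close>

lemma tendsto_det:
  fixes A :: "'a \<Rightarrow> real^'n^'n"
  assumes "(A \<longlongrightarrow> L) F"
  shows "((\<lambda>x. det (A x)) \<longlongrightarrow> det L) F"
  unfolding det_def by (intro tendsto_intros assms)

lemma matrix_inv_nonsingular:
  fixes A :: "real^'n^'n"
  assumes "det A \<noteq> 0"
  shows "A ** matrix_inv A = mat 1" "matrix_inv A ** A = mat 1"
proof -
  have "\<exists>B. A ** B = mat 1 \<and> B ** A = mat 1"
    using assms invertible_det_nz[of A] by (simp add: invertible_def)
  from someI_ex[OF this] show "A ** matrix_inv A = mat 1" "matrix_inv A ** A = mat 1"
    by (auto simp: matrix_inv_def)
qed

text \<open>For a singular matrix the defining choice ranges over the empty predicate and so always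
  returns the same value. Hence \<open>matrix_inv\<close> is continuous on the open set of
  nonsingular matrices and constant off it, which makes it Borel on the whole space.\<close>

lemma matrix_inv_singular:
  fixes A :: "real^'n^'n"
  assumes "det A = 0"
  shows "matrix_inv A = matrix_inv 0"
proof -
  have *: "(\<lambda>B. A ** B = mat 1 \<and> B ** A = mat 1) = (\<lambda>B. False)" if "det A = 0" for A :: "real^'n^'n"
    using that invertible_det_nz[of A] by (auto simp: invertible_def)
  have "matrix_inv B = (SOME C :: real^'n^'n. False)" if "det B = 0" for B :: "real^'n^'n"
    unfolding matrix_inv_def *[OF that] ..
  then show ?thesis
    using assms by (simp add: det_eq_0_rank)
qed

text \<open>Column \<open>j\<close> of the inverse solves a linear system with right-hand side
  \<open>axis j 1\<close>. Cramer's rule writes the entries as quotients of determinants, from which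
  continuity at nonsingular matrices is read off.\<close>

lemma matrix_inv_cramer:
  fixes A :: "real^'n^'n"
  assumes "det A \<noteq> 0"
  shows "matrix_inv A = (\<chi> k j. det (\<chi> i l. if l = k then axis j 1 $ i else A $ i $ l) / det A)"
proof -
  have "matrix_inv A $ k $ j = det (\<chi> i l. if l = k then axis j 1 $ i else A $ i $ l) / det A" for k j
  proof -
    have "A *v (matrix_inv A *v axis j 1) = axis j 1"
      by (simp add: matrix_vector_mul_assoc matrix_inv_nonsingular assms)
    then have "matrix_inv A *v axis j 1 =
        (\<chi> k. det (\<chi> i l. if l = k then axis j 1 $ i else A $ i $ l) / det A)"
      using cramer[OF assms] by blast
    moreover have "(matrix_inv A *v axis j 1) $ k = matrix_inv A $ k $ j"
      by (simp add: matrix_vector_mult_basis column_def)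
    ultimately show ?thesis by simp
  qed
  then show ?thesis by (simp add: vec_eq_iff)
qed

lemma tendsto_matrix_inv:
  fixes A :: "'a \<Rightarrow> real^'n^'n"
  assumes A: "(A \<longlongrightarrow> L) F" and L: "det L \<noteq> 0"
  shows "((\<lambda>x. matrix_inv (A x)) \<longlongrightarrow> matrix_inv L) F"
proof -
  have nz: "\<forall>\<^sub>F x in F. det (A x) \<noteq> 0"
    using tendsto_imp_eventually_ne[OF tendsto_det[OF A] L] .
  have "((\<lambda>x. if l = k then (axis j 1 :: real^'n) $ i else A x $ i $ l)
      \<longlongrightarrow> (if l = k then axis j 1 $ i else L $ i $ l)) F" for k j i l
    by (cases "l = k") (auto intro!: tendsto_intros A)
  then have "((\<lambda>x. \<chi> k j. det (\<chi> i l. if l = k then axis j 1 $ i else A x $ i $ l) / det (A x))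
      \<longlongrightarrow> (\<chi> k j. det (\<chi> i l. if l = k then axis j 1 $ i else L $ i $ l) / det L)) F"
    by (intro tendsto_vec_lambda tendsto_divide tendsto_det A L)
  then show ?thesis
    unfolding matrix_inv_cramer[OF L, symmetric]
    by (rule Lim_transform_eventually) (use nz in eventually_elim, simp add: matrix_inv_cramer)
qed

lemma borel_measurable_matrix_inv [measurable]:
  "(matrix_inv :: real^'n^'n \<Rightarrow> real^'n^'n) \<in> borel_measurable borel"
proof -
  have "open {A :: real^'n^'n. det A \<noteq> 0}"
    by (intro open_Collect_neq continuous_intros)
      (unfold continuous_on_def, intro ballI tendsto_det tendsto_ident_at)
  moreover have "continuous_on {A :: real^'n^'n. det A \<noteq> 0} matrix_inv"
    unfolding continuous_on_def by (intro ballI tendsto_matrix_inv tendsto_ident_at) simp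
  ultimately have "(\<lambda>A :: real^'n^'n. if A \<in> {A. det A \<noteq> 0} then matrix_inv A else matrix_inv 0)
      \<in> borel_measurable borel"
    by (intro borel_measurable_continuous_on_if) auto
  also have "(\<lambda>A :: real^'n^'n. if A \<in> {A. det A \<noteq> 0} then matrix_inv A else matrix_inv 0) = matrix_inv"
    using matrix_inv_singular[symmetric] by (auto simp: fun_eq_iff)
  finally show ?thesis .
qed

section \<open>Vectorization and the weighted quadratic form\<close>

lemma linear_vectorize: "linear vectorize"
  by (rule linearI) (simp_all add: vectorize_def vec_eq_iff)

lemmas vectorize_diff = linear_diff[OF linear_vectorize]
  and vectorize_add = linear_add[OF linear_vectorize]
  and vectorize_scaleR = linear_scale[OF linear_vectorize]
  and vectorize_0 = linear_0[OF linear_vectorize]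
  and tendsto_vectorize = bounded_linear.tendsto[OF linear_conv_bounded_linear[THEN iffD1, OF linear_vectorize]]

lemma inner_vectorize: "vectorize A \<bullet> vectorize B = A \<bullet> B"
proof -
  have "vectorize A \<bullet> vectorize B = (\<Sum>j\<in>UNIV. \<Sum>i\<in>UNIV. A $ i $ j * B $ i $ j)"
    by (simp add: inner_vec_def vectorize_def sum.cartesian_product case_prod_unfold)
  also have "\<dots> = A \<bullet> B"
    by (subst sum.swap) (simp add: inner_vec_def)
  finally show ?thesis .
qed

lemma norm_vectorize: "norm (vectorize A) = norm A"
  by (simp add: norm_eq_sqrt_inner inner_vectorize)

definition unvectorize :: "real^('h \<times> 'p) \<Rightarrow> real^'h^'p" where
  "unvectorize v = (\<chi> i j. v $ (j, i))"

lemma vectorize_unvectorize [simp]: "vectorize (unvectorize v) = v"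
  by (simp add: vectorize_def unvectorize_def vec_eq_iff)

lemma unvectorize_vectorize [simp]: "unvectorize (vectorize A) = A"
  by (simp add: vectorize_def unvectorize_def vec_eq_iff)

lemma linear_unvectorize: "linear unvectorize"
  by (rule linearI) (simp_all add: unvectorize_def vec_eq_iff)

lemma weighted_sq_scaleR: "weighted_sq G (c *\<^sub>R A) = c\<^sup>2 * weighted_sq G A"
  by (simp add: weighted_sq_def vectorize_scaleR power2_eq_square matrix_vector_mult_scaleR)

lemma weighted_sq_0: "weighted_sq G 0 = 0"
  by (simp add: weighted_sq_def vectorize_0)

lemma tendsto_weighted_sq:
  assumes "(G \<longlongrightarrow> \<Gamma>) F" "det \<Gamma> \<noteq> 0" "(A \<longlongrightarrow> L) F"
  shows "((\<lambda>x. weighted_sq (G x) (A x)) \<longlongrightarrow> weighted_sq \<Gamma> L) F"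
  unfolding weighted_sq_def
  by (intro tendsto_inner tendsto_matrix_vector_mult tendsto_matrix_inv tendsto_vectorize assms)

lemma continuous_on_weighted_sq: "continuous_on UNIV (weighted_sq G)"
  unfolding weighted_sq_def continuous_on_def
  by (intro ballI tendsto_inner tendsto_matrix_vector_mult tendsto_vectorize tendsto_const tendsto_ident_at)

text \<open>For any quadratic form, symmetric or not, the convexity defect is exactly
  \<open>t * (1 - t)\<close> times the form at \<open>A - B\<close>.\<close>

lemma convex_on_weighted_sq:
  assumes "\<And>A. 0 \<le> weighted_sq G A"
  shows "convex_on UNIV (weighted_sq G)"
proof (rule convex_onI)
  fix t :: real and A B assume t: "0 < t" "t < 1"
  have "weighted_sq G ((1 - t) *\<^sub>R A + t *\<^sub>R B) =
      (1 - t) * weighted_sq G A + t * weighted_sq G B - t * (1 - t) * weighted_sq G (A - B)"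
    by (simp add: weighted_sq_def vectorize_scaleR vectorize_add vectorize_diff
        matrix_vector_right_distrib matrix_vector_mult_diff_distrib matrix_vector_mult_scaleR
        inner_add_left inner_add_right inner_diff_left inner_diff_right algebra_simps power2_eq_square)
  moreover have "0 \<le> t * (1 - t) * weighted_sq G (A - B)"
    using t assms by simp
  ultimately show "weighted_sq G ((1 - t) *\<^sub>R A + t *\<^sub>R B) \<le> (1 - t) * weighted_sq G A + t * weighted_sq G B"
    by simp
qed simp

text \<open>A nonnegative form that vanishes at \<open>x\<close> has a minimum there. If
  \<open>y = \<Sigma> *v x\<close> were nonzero, a small step from \<open>x\<close> along
  \<open>- y\<close> would make the form negative.\<close>

lemma covariance_matrix_pos:
  assumes cov: "covariance_matrix \<Sigma>" and det: "det \<Sigma> \<noteq> 0" and x: "x \<noteq> 0"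
  shows "0 < x \<bullet> (\<Sigma> *v x)"
proof (rule ccontr)
  assume "\<not> ?thesis"
  then have x0: "x \<bullet> (\<Sigma> *v x) = 0"
    using cov by (auto simp: covariance_matrix_def intro: antisym)
  define y where "y = \<Sigma> *v x"
  have sym: "u \<bullet> (\<Sigma> *v v) = v \<bullet> (\<Sigma> *v u)" for u v
    using cov by (metis covariance_matrix_def dot_lmul_matrix inner_commute transpose_matrix_vector)
  have quad: "0 \<le> 2 * t * (y \<bullet> y) + t\<^sup>2 * (y \<bullet> (\<Sigma> *v y))" for t
  proof -
    have "0 \<le> (x + t *\<^sub>R y) \<bullet> (\<Sigma> *v (x + t *\<^sub>R y))"
      using cov by (simp add: covariance_matrix_def)
    also have "\<dots> = 2 * t * (y \<bullet> y) + t\<^sup>2 * (y \<bullet> (\<Sigma> *v y))"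
      using x0 sym[of x y]
      by (simp add: matrix_vector_right_distrib matrix_vector_mult_scaleR inner_add_left
          inner_add_right algebra_simps power2_eq_square y_def[symmetric])
    finally show ?thesis .
  qed
  have "y \<noteq> 0"
    using x det matrix_inv_nonsingular(2)[OF det]
    by (metis y_def matrix_vector_mul_assoc matrix_vector_mul_lid matrix_vector_mult_0_right)
  then have yy: "0 < y \<bullet> y" by simp
  let ?c = "y \<bullet> (\<Sigma> *v y)"
  have c: "0 \<le> ?c" using cov by (simp add: covariance_matrix_def)
  \<comment> \<open>At \<open>t = - s\<close> the quadratic polynomial equals
    \<open>- (s\<^sup>2 * (?c + 2))\<close>; the summand 1 in the denominator covers the case
    \<open>?c = 0\<close>.\<close>
  define s where "s = (y \<bullet> y) / (?c + 1)"
  have yy_s: "y \<bullet> y = s * (?c + 1)" and "0 < s"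
    using c yy by (simp_all add: s_def)
  have "0 \<le> - (s\<^sup>2 * (?c + 2))"
    using quad[of "- s"] unfolding yy_s by (simp add: algebra_simps power2_eq_square)
  moreover have "0 < s\<^sup>2 * (?c + 2)"
    using c \<open>0 < s\<close> by simp
  ultimately show False by simp
qed

text \<open>With \<open>x = matrix_inv \<Gamma> *v vectorize A\<close> the form of the inverse at
  \<open>vectorize A\<close> is the form of \<open>\<Gamma>\<close> at \<open>x\<close>, so
  positivity passes over directly.\<close>

lemma weighted_sq_pos:
  assumes cov: "covariance_matrix \<Gamma>" and det: "det \<Gamma> \<noteq> 0" and A: "A \<noteq> 0"
  shows "0 < weighted_sq \<Gamma> A"
proof -
  define x where "x = matrix_inv \<Gamma> *v vectorize A"
  have eq: "vectorize A = \<Gamma> *v x"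
    by (simp add: x_def matrix_vector_mul_assoc matrix_inv_nonsingular det)
  have "x \<noteq> 0"
    using A eq norm_vectorize[of A] by auto
  then show ?thesis
    using covariance_matrix_pos[OF cov det] eq by (metis inner_commute weighted_sq_def x_def)
qed

text \<open>Compactness of the unit sphere and homogeneity give the bounds at
  \<open>\<Gamma>\<close>; continuity of the inverse carries them to a whole neighbourhood with the
  same constants. Only the norm of the difference of the inverses is used, so the bounds apply to
  every nearby value of an estimator of \<open>\<Gamma>\<close>, symmetric or not.\<close>

lemma weighted_sq_bounds:
  fixes \<Gamma> :: "real^('a::finite \<times> 'b::finite)^('a \<times> 'b)"
  assumes cov: "covariance_matrix \<Gamma>" and det: "det \<Gamma> \<noteq> 0"
  obtains c C where "0 < c" "0 < C"
    "\<forall>\<^sub>F G in nhds \<Gamma>. \<forall>A. c * (norm A)\<^sup>2 \<le> weighted_sq G A \<and> weighted_sq G A \<le> C * (norm A)\<^sup>2"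
proof -
  let ?S = "sphere 0 1 :: (real^'a^'b) set"
  have ne: "?S \<noteq> {}"
    by simp
  obtain a where a: "a \<in> ?S" "\<And>A. A \<in> ?S \<Longrightarrow> weighted_sq \<Gamma> a \<le> weighted_sq \<Gamma> A"
    using continuous_attains_inf[OF compact_sphere ne continuous_on_subset[OF continuous_on_weighted_sq]]
    by (metis subset_UNIV)
  obtain b where b: "b \<in> ?S" "\<And>A. A \<in> ?S \<Longrightarrow> weighted_sq \<Gamma> A \<le> weighted_sq \<Gamma> b"
    using continuous_attains_sup[OF compact_sphere ne continuous_on_subset[OF continuous_on_weighted_sq]]
    by (metis subset_UNIV)
  \<comment> \<open>Half of the minimum over the sphere: a perturbation of relative size
    \<open>e\<close> leaves the lower bound \<open>2 * e - e = e\<close>.\<close>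
  define e where "e = weighted_sq \<Gamma> a / 2"
  have e: "0 < e" using a(1) weighted_sq_pos[OF cov det, of a] by (force simp: e_def)
  have ab: "weighted_sq \<Gamma> a \<le> weighted_sq \<Gamma> b" using a b by blast
  obtain K where K: "0 < K" "\<And>(M :: real^('a \<times> 'b)^('a \<times> 'b)) x. norm (M *v x) \<le> norm M * norm x * K"
    using bounded_bilinear.pos_bounded[OF bounded_bilinear_matrix_vector_mult] by blast
  have "((\<lambda>G. matrix_inv G) \<longlongrightarrow> matrix_inv \<Gamma>) (nhds \<Gamma>)"
    by (intro tendsto_matrix_inv det filterlim_ident)
  then have "\<forall>\<^sub>F G in nhds \<Gamma>. dist (matrix_inv G) (matrix_inv \<Gamma>) < e / K"
    using e K tendstoD by (metis divide_pos_pos)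
  then have ev: "\<forall>\<^sub>F G in nhds \<Gamma>. \<forall>A. e * (norm A)\<^sup>2 \<le> weighted_sq G A \<and>
      weighted_sq G A \<le> (weighted_sq \<Gamma> b + e) * (norm A)\<^sup>2"
  proof eventually_elim
    case (elim G)
    show ?case
    proof
      fix A :: "real^'a^'b"
      have "\<bar>weighted_sq G A - weighted_sq \<Gamma> A\<bar> =
          \<bar>vectorize A \<bullet> ((matrix_inv G - matrix_inv \<Gamma>) *v vectorize A)\<bar>"
        by (simp add: weighted_sq_def matrix_vector_mult_diff_rdistrib inner_diff_right)
      also have "\<dots> \<le> norm (vectorize A) * norm ((matrix_inv G - matrix_inv \<Gamma>) *v vectorize A)"
        by (rule Cauchy_Schwarz_ineq2)
      also have "\<dots> \<le> norm A * (e / K * norm A * K)"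
        unfolding norm_vectorize
        by (intro mult_left_mono order_trans[OF K(2)])
          (use elim K(1) in \<open>auto simp: dist_norm norm_vectorize simp del: times_divide_eq_left intro!: mult_right_mono\<close>)
      also have "\<dots> = e * (norm A)\<^sup>2"
        using K(1) by (simp add: power2_eq_square)
      finally have 1: "\<bar>weighted_sq G A - weighted_sq \<Gamma> A\<bar> \<le> e * (norm A)\<^sup>2" .
      have "weighted_sq \<Gamma> a * (norm A)\<^sup>2 \<le> weighted_sq \<Gamma> A \<and> weighted_sq \<Gamma> A \<le> weighted_sq \<Gamma> b * (norm A)\<^sup>2"
      proof (cases "A = 0")
        case False
        define E where "E = (1 / norm A) *\<^sub>R A"
        have "E \<in> ?S" using False by (simp add: E_def)
        moreover have "A = norm A *\<^sub>R E" using False by (simp add: E_def)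
        then have "weighted_sq \<Gamma> A = (norm A)\<^sup>2 * weighted_sq \<Gamma> E"
          by (metis weighted_sq_scaleR)
        ultimately show ?thesis
          using a(2)[of E] b(2)[of E] by (auto simp: mult.commute intro: mult_right_mono)
      qed (simp add: weighted_sq_0)
      moreover have "weighted_sq \<Gamma> a * (norm A)\<^sup>2 = 2 * (e * (norm A)\<^sup>2)"
        by (simp add: e_def)
      ultimately show "e * (norm A)\<^sup>2 \<le> weighted_sq G A \<and>
          weighted_sq G A \<le> (weighted_sq \<Gamma> b + e) * (norm A)\<^sup>2"
        using 1 unfolding distrib_right abs_le_iff by linarith
    qed
  qed
  show ?thesis
    by (rule that[OF e _ ev]) (use e ab in \<open>auto simp: e_def\<close>)
qed

section \<open>Matrices of fixed rank\<close>

text \<open>A matrix is injective on its row space, hence bounded below there, and a small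
  perturbation costs at most half of the bound. The subspace is the row space of \<open>A\<close>,
  so it stays fixed while \<open>B\<close> varies.\<close>

lemma row_space_bounded_below:
  fixes A :: "real^'n^'m"
  obtains c where "0 < c"
    "\<forall>\<^sub>F B in nhds A. \<forall>x\<in>span (rows A). c * norm x \<le> norm (B *v x)"
proof -
  have "\<forall>x\<in>span (rows A). A *v x = 0 \<longrightarrow> x = 0"
    using nullspace_inter_rowspace[of A] by blast
  then obtain e where e: "0 < e" "\<And>x. x \<in> span (rows A) \<Longrightarrow> e * norm x \<le> norm (A *v x)"
    using injective_imp_isometric[of "span (rows A)" "(*v) A"]
    by (auto simp: closed_subspace subspace_span matrix_vector_mul_bounded_linear)
  obtain K where K: "0 < K" "\<And>(M :: real^'n^'m) x. norm (M *v x) \<le> norm M * norm x * K"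
    using bounded_bilinear.pos_bounded[OF bounded_bilinear_matrix_vector_mult] by blast
  have "((\<lambda>B. B) \<longlongrightarrow> A) (nhds A)"
    by (rule filterlim_ident)
  then have "\<forall>\<^sub>F B in nhds A. dist B A < e / 2 / K"
    using e K by (intro tendstoD) auto
  then have "\<forall>\<^sub>F B in nhds A. \<forall>x\<in>span (rows A). e / 2 * norm x \<le> norm (B *v x)"
  proof eventually_elim
    case (elim B)
    show ?case
    proof
      fix x assume x: "x \<in> span (rows A)"
      have "norm ((A - B) *v x) \<le> (e / 2 / K) * norm x * K"
        using elim K(1) by (intro order_trans[OF K(2)] mult_right_mono) (auto simp: dist_norm norm_minus_commute)
      then have "norm (A *v x - B *v x) \<le> e / 2 * norm x"
        using K(1) by (simp add: matrix_vector_mult_diff_rdistrib)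
      moreover have "norm (A *v x) \<le> norm (B *v x) + norm (A *v x - B *v x)"
        by (metis norm_triangle_sub)
      ultimately show "e / 2 * norm x \<le> norm (B *v x)"
        using e(2)[OF x] by linarith
    qed
  qed
  then show ?thesis
    using that[of "e / 2"] e(1) by simp
qed

text \<open>Matrices near \<open>A\<close> remain injective on the row space of \<open>A\<close>,
  which has dimension \<open>rank A\<close>.\<close>

lemma rank_lower_semicontinuous:
  fixes A :: "real^'n^'m"
  shows "\<forall>\<^sub>F B in nhds A. rank A \<le> rank B"
proof -
  obtain c where c: "0 < c" and ev: "\<forall>\<^sub>F B in nhds A. \<forall>x\<in>span (rows A). c * norm x \<le> norm (B *v x)"
    by (rule row_space_bounded_below)
  from ev show ?thesis
  proof eventually_elim
    case (elim B)
    have "inj_on ((*v) B) (span (rows A))"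
    proof (rule inj_onI)
      fix x y assume xy: "x \<in> span (rows A)" "y \<in> span (rows A)" "B *v x = B *v y"
      have "c * norm (x - y) \<le> norm (B *v (x - y))"
        using elim span_diff[OF xy(1,2)] by blast
      also have "\<dots> = 0"
        using xy(3) by (simp add: matrix_vector_mult_diff_distrib)
      finally show "x = y"
        using c by (simp add: mult_le_0_iff)
    qed
    then have "dim ((*v) B ` rows A) = dim (rows A)"
      by (intro dim_image_eq) (auto simp: matrix_vector_mul_linear)
    then have "rank A = dim ((*v) B ` rows A)"
      by (simp add: row_rank_def)
    also have "\<dots> \<le> rank B"
      unfolding rank_dim_range by (intro dim_subset) auto
    finally show ?case .
  qed
qed

lemma closed_rank_le: "closed {A :: real^'n^'m. rank A \<le> k}"
proof -
  have "open {A :: real^'n^'m. k < rank A}"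
  proof (subst open_subopen, safe)
    fix A :: "real^'n^'m" assume "k < rank A"
    with rank_lower_semicontinuous[of A] have "\<forall>\<^sub>F B in nhds A. k < rank B"
      by (auto elim: eventually_mono)
    then show "\<exists>T. open T \<and> A \<in> T \<and> T \<subseteq> {A. k < rank A}"
      by (auto simp: eventually_nhds)
  qed
  moreover have "{A :: real^'n^'m. rank A \<le> k} = - {A. k < rank A}"
    by auto
  ultimately show ?thesis
    by (simp add: closed_def)
qed

section \<open>Kernels under constant rank\<close>

lemma dim_nullspace:
  fixes A :: "real^'n^'m"
  shows "dim {x. A *v x = 0} + rank A = CARD('n)"
proof -
  have "{x. A *v x = 0} = {y \<in> UNIV. \<forall>x\<in>span (rows A). orthogonal x y}"
  proof (safe intro!: orthogonal_nullspace_rowspace[THEN orthogonal_commute[THEN iffD1]])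
    fix y assume y: "\<forall>x\<in>span (rows A). orthogonal x y"
    have "(A *v y) $ i = 0" for i
    proof -
      have "orthogonal (row i A) y"
        using y span_base[of "row i A" "rows A"] by (auto simp: rows_def)
      then show ?thesis
        by (simp add: matrix_vector_mul_component orthogonal_def row_def)
    qed
    then show "A *v y = 0" by (simp add: vec_eq_iff)
  qed simp_all
  then show ?thesis
    using dim_subspace_orthogonal_to_vectors[of "span (rows A)" UNIV]
    by (simp add: row_rank_def)
qed

text \<open>The row space of \<open>A\<close> meets the kernel of \<open>B n\<close> trivially by
  the lower bound, and equality of ranks makes their dimensions add up to the full dimension. The
  kernel component of \<open>x\<close> in this decomposition is the required approximation. If the
  rank of \<open>B n\<close> exceeded that of \<open>A\<close>, the kernel could collapse.\<close>

lemma nullspace_inner_semicontinuous: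
  fixes B :: "nat \<Rightarrow> real^'n^'m"
  assumes B: "B \<longlonglongrightarrow> A" and rank: "\<forall>\<^sub>F n in sequentially. rank (B n) = rank A"
    and x: "A *v x = 0"
  obtains y where "y \<longlonglongrightarrow> x" "\<forall>\<^sub>F n in sequentially. B n *v y n = 0"
proof -
  let ?V = "span (rows A)"
  obtain c where c: "0 < c" and "\<forall>\<^sub>F B in nhds A. \<forall>x\<in>?V. c * norm x \<le> norm (B *v x)"
    by (rule row_space_bounded_below)
  with B have ev: "\<forall>\<^sub>F n in sequentially. \<forall>x\<in>?V. c * norm x \<le> norm (B n *v x)"
    by (auto intro: eventually_compose_filterlim)
  have "\<forall>\<^sub>F n in sequentially. \<exists>y. B n *v y = 0 \<and> c * norm (x - y) \<le> norm (B n *v x)"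
    using ev rank
  proof eventually_elim
    case (elim n)
    let ?N = "{y. B n *v y = 0}"
    have N: "subspace ?N"
      by (auto simp: subspace_def matrix_vector_right_distrib matrix_vector_mult_scaleR)
    have "?V \<inter> ?N = {0}"
      using elim(1) c by (fastforce simp: mult_le_0_iff span_zero)
    then have "dim {u + v |u v. u \<in> ?V \<and> v \<in> ?N} = dim ?V + dim ?N"
      using dim_sums_Int[OF subspace_span N, of "rows A"] by simp
    also have "\<dots> = CARD('n)"
      using dim_nullspace[of "B n"] elim(2) by (simp add: row_rank_def)
    finally have "{u + v |u v. u \<in> ?V \<and> v \<in> ?N} = UNIV"
      using dim_eq_full[of "{u + v |u v. u \<in> ?V \<and> v \<in> ?N}"] span_eq_iff[THEN iffD2, OF subspace_sums[OF subspace_span N, of "rows A"]]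
      by simp
    then obtain u v where uv: "x = u + v" "u \<in> ?V" "v \<in> ?N"
      by blast
    \<comment> \<open>The vector \<open>x - v\<close> lies in the row space of \<open>A\<close>, and
      \<open>B n\<close> maps it to \<open>B n *v x\<close>, which tends to
      \<open>A *v x = 0\<close>.\<close>
    then have "c * norm (x - v) \<le> norm (B n *v x)"
      using elim(1) by (simp add: matrix_vector_right_distrib)
    with uv(3) show ?case by blast
  qed
  then obtain y where y: "\<forall>\<^sub>F n in sequentially. B n *v y n = 0 \<and> c * norm (x - y n) \<le> norm (B n *v x)"
    unfolding eventually_ex ..
  have "(\<lambda>n. norm (B n *v x) / c) \<longlonglongrightarrow> norm (A *v x) / c"
    using c by (intro tendsto_intros tendsto_matrix_vector_mult B) auto
  then have "(\<lambda>n. norm (B n *v x) / c) \<longlonglongrightarrow> 0"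
    by (simp add: x)
  then have "(\<lambda>n. y n - x) \<longlonglongrightarrow> 0"
    by (rule Lim_null_comparison[rotated])
      (use y in eventually_elim, use c in \<open>simp add: field_simps norm_minus_commute\<close>)
  then have "y \<longlonglongrightarrow> x"
    by (simp add: LIM_zero_iff)
  then show ?thesis
    by (rule that) (use y in \<open>auto elim: eventually_mono\<close>)
qed

text \<open>Tangent space at \<open>M\<close> of the manifold of matrices with the rank of \<open>M\<close>.\<close>

definition rank_tangent :: "real^'n^'m \<Rightarrow> (real^'n^'m) set" where
  "rank_tangent M = {U ** M + M ** V |U V. True}"

lemma subspace_rank_tangent: "subspace (rank_tangent M)"
  unfolding subspace_def
proof (intro conjI ballI allI)
  show "0 \<in> rank_tangent M"
    by (auto simp: rank_tangent_def matrix_matrix_mult_def vec_eq_iff intro!: exI[of _ 0])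
next
  fix X Y assume "X \<in> rank_tangent M" "Y \<in> rank_tangent M"
  then obtain U V U' V' where "X = U ** M + M ** V" "Y = U' ** M + M ** V'"
    by (auto simp: rank_tangent_def)
  then have "X + Y = (U + U') ** M + M ** (V + V')"
    by (simp add: matrix_add_rdistrib matrix_add_ldistrib)
  then show "X + Y \<in> rank_tangent M"
    by (auto simp: rank_tangent_def)
next
  fix c X assume "X \<in> rank_tangent M"
  then obtain U V where "X = U ** M + M ** V"
    by (auto simp: rank_tangent_def)
  then have "c *\<^sub>R X = (c *\<^sub>R U) ** M + M ** (c *\<^sub>R V)"
    by (simp add: matrix_matrix_mult_scaleR scaleR_add_right)
  then show "c *\<^sub>R X \<in> rank_tangent M"
    by (auto simp: rank_tangent_def)
qed

text \<open>Any linear right inverse of \<open>A\<close> on its range will do. The products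
  \<open>A ** N\<close> and \<open>N ** A\<close> are then idempotent and take over the role of
  orthogonal projections.\<close>

lemma generalized_inverse:
  fixes A :: "real^'n^'m"
  obtains N :: "real^'m^'n" where "A ** N ** A = A"
proof -
  obtain g where g: "linear g" "\<forall>v\<in>range ((*v) A). A *v g v = v"
    using linear_exists_right_inverse_on[OF matrix_vector_mul_linear[of A] subspace_UNIV] by blast
  have "A ** matrix g ** A = A"
    by (subst matrix_eq) (use g in \<open>auto simp: matrix_vector_mul_assoc[symmetric] matrix_works\<close>)
  then show ?thesis by (rule that)
qed

text \<open>This dual description passes to limits, whereas the factors \<open>U\<close> and
  \<open>V\<close> of a tangent matrix need not converge. For the converse,
  \<open>mat 1 - N ** M\<close> maps into the kernel and \<open>mat 1 - M ** N\<close>, acting from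
  the right on row vectors, into the left kernel. Hence
  \<open>(mat 1 - M ** N) ** T ** (mat 1 - N ** M)\<close> vanishes, and expanding it exhibits
  \<open>T\<close> as a tangent matrix.\<close>

lemma rank_tangent_iff:
  fixes M :: "real^'n^'m"
  shows "T \<in> rank_tangent M \<longleftrightarrow> (\<forall>x y. M *v x = 0 \<longrightarrow> y v* M = 0 \<longrightarrow> y \<bullet> (T *v x) = 0)"
proof
  assume "T \<in> rank_tangent M"
  then obtain U V where T: "T = U ** M + M ** V"
    by (auto simp: rank_tangent_def)
  have "y \<bullet> (T *v x) = y \<bullet> (U *v (M *v x)) + (y v* M) \<bullet> (V *v x)" for x y
    by (simp add: T matrix_vector_mult_add_rdistrib inner_add_right dot_lmul_matrix
        matrix_vector_mul_assoc)
  then show "\<forall>x y. M *v x = 0 \<longrightarrow> y v* M = 0 \<longrightarrow> y \<bullet> (T *v x) = 0"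
    by simp
next
  assume T: "\<forall>x y. M *v x = 0 \<longrightarrow> y v* M = 0 \<longrightarrow> y \<bullet> (T *v x) = 0"
  obtain N where N: "M ** N ** M = M"
    by (rule generalized_inverse)
  have "y \<bullet> (T *v x) = y \<bullet> ((M ** N ** T + T ** N ** M - M ** N ** T ** N ** M) *v x)" for x y
  proof -
    have "M *v (x - (N ** M) *v x) = 0"
      by (simp add: matrix_vector_mult_diff_distrib matrix_vector_mul_assoc matrix_mul_assoc N)
    moreover have "(y - y v* (M ** N)) v* M = 0"
      unfolding transpose_matrix_vector[symmetric] matrix_vector_mult_diff_distrib
      unfolding transpose_matrix_vector vector_matrix_mul_assoc N by simp
    ultimately have "(y - y v* (M ** N)) \<bullet> (T *v (x - (N ** M) *v x)) = 0"
      using T by blast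
    then show ?thesis
      by (simp add: matrix_vector_mult_diff_distrib matrix_vector_mult_diff_rdistrib
          matrix_vector_mult_add_rdistrib inner_diff_left inner_diff_right inner_add_right
          dot_lmul_matrix matrix_vector_mul_assoc matrix_mul_assoc)
  qed
  then have "T *v x = (M ** N ** T + T ** N ** M - M ** N ** T ** N ** M) *v x" for x
    by (metis vector_eq_rdot inner_commute)
  then have "T = M ** N ** T + T ** N ** M - M ** N ** T ** N ** M"
    by (subst matrix_eq) blast
  also have "\<dots> = (T ** N) ** M + M ** (N ** T - N ** T ** N ** M)"
    by (subst matrix_eq) (simp add: matrix_vector_mult_add_rdistrib matrix_vector_mult_diff_rdistrib
        matrix_vector_mul_assoc[symmetric] matrix_vector_mult_diff_distrib)
  finally show "T \<in> rank_tangent M"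
    by (auto simp: rank_tangent_def)
qed

lemma rank_nonsingular_mult:
  fixes A :: "real^'n^'m"
  assumes "det P \<noteq> 0" "det Q \<noteq> 0"
  shows "rank (P ** A ** Q) = rank A"
proof (rule antisym)
  show "rank (P ** A ** Q) \<le> rank A"
    using rank_mul_le_left[of "P ** A" Q] rank_mul_le_right[of P A] by linarith
  have "A = matrix_inv P ** (P ** A ** Q) ** matrix_inv Q"
    by (subst matrix_eq)
      (metis assms matrix_inv_nonsingular matrix_mul_assoc matrix_mul_lid matrix_mul_rid)
  then show "rank A \<le> rank (P ** A ** Q)"
    using rank_mul_le_left[of "matrix_inv P ** (P ** A ** Q)" "matrix_inv Q"]
      rank_mul_le_right[of "matrix_inv P" "P ** A ** Q"] by simp
qed

text \<open>For small \<open>t\<close> the factors \<open>mat 1 + t *\<^sub>R U\<close> and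
  \<open>mat 1 + t *\<^sub>R V\<close> are nonsingular, so multiplying \<open>A n\<close> by them
  from the left and from the right preserves its rank. Expanding the product gives the curve
  \<open>A n + t n *\<^sub>R S n\<close>, whatever the base points \<open>A n\<close> are.\<close>

lemma rank_tangent_approx:
  fixes A :: "nat \<Rightarrow> real^'n^'m"
  assumes A: "A \<longlonglongrightarrow> M" and t: "t \<longlonglongrightarrow> 0" and T: "T \<in> rank_tangent M"
  obtains S where "S \<longlonglongrightarrow> T" "\<forall>\<^sub>F n in sequentially. rank (A n + t n *\<^sub>R S n) = rank (A n)"
proof -
  obtain U V where T_eq: "T = U ** M + M ** V"
    using T by (auto simp: rank_tangent_def)
  define S where "S n = U ** A n + A n ** V + t n *\<^sub>R (U ** A n ** V)" for n
  have "S \<longlonglongrightarrow> U ** M + M ** V + 0 *\<^sub>R (U ** M ** V)"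
    unfolding S_def by (intro tendsto_intros tendsto_matrix_matrix_mult A t)
  then have "S \<longlonglongrightarrow> T"
    by (simp add: T_eq)
  moreover have "\<forall>\<^sub>F n in sequentially. rank (A n + t n *\<^sub>R S n) = rank (A n)"
  proof -
    have nz: "\<forall>\<^sub>F n in sequentially. det (mat 1 + t n *\<^sub>R W) \<noteq> 0" for W :: "real^'k^'k"
    proof -
      have "(\<lambda>n. det (mat 1 + t n *\<^sub>R W)) \<longlonglongrightarrow> det (mat 1 + 0 *\<^sub>R W)"
        by (intro tendsto_det tendsto_intros t)
      then show ?thesis
        by (intro tendsto_imp_eventually_ne) auto
    qed
    show ?thesis
      using nz[of U] nz[of V]
    proof eventually_elim
      case (elim n)
      have "(mat 1 + t n *\<^sub>R U) ** A n ** (mat 1 + t n *\<^sub>R V) = A n + t n *\<^sub>R S n"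
        by (simp add: S_def matrix_add_rdistrib matrix_add_ldistrib
            matrix_matrix_mult_scaleR scaleR_add_right)
      then show ?case
        using rank_nonsingular_mult[OF elim, of "A n"] by simp
    qed
  qed
  ultimately show ?thesis by (rule that)
qed

text \<open>Difference quotients between matrices of constant rank are asymptotically tangent even if both
  end points move: vectors in the kernel of one and in the cokernel of the other annihilate them.\<close>

lemma rank_tangent_limit:
  fixes A S :: "nat \<Rightarrow> real^'n^'m"
  assumes A: "A \<longlonglongrightarrow> M" and rA: "\<forall>\<^sub>F n in sequentially. rank (A n) = rank M"
    and t: "t \<longlonglongrightarrow> 0" "\<And>n. t n \<noteq> 0"
    and S: "S \<longlonglongrightarrow> T" and rB: "\<forall>\<^sub>F n in sequentially. rank (A n + t n *\<^sub>R S n) = rank M"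
  shows "T \<in> rank_tangent M"
  unfolding rank_tangent_iff
proof safe
  fix x y assume x: "M *v x = 0" and y: "y v* M = 0"
  have "(\<lambda>n. A n + t n *\<^sub>R S n) \<longlonglongrightarrow> M + 0 *\<^sub>R T"
    by (intro tendsto_intros A t S)
  then have B: "(\<lambda>n. A n + t n *\<^sub>R S n) \<longlonglongrightarrow> M" by simp
  obtain u where u: "u \<longlonglongrightarrow> x" "\<forall>\<^sub>F n in sequentially. (A n + t n *\<^sub>R S n) *v u n = 0"
    using nullspace_inner_semicontinuous[OF B rB x] .
  have "(\<lambda>n. transpose (A n)) \<longlonglongrightarrow> transpose M"
    unfolding transpose_def by (intro tendsto_vec_lambda tendsto_vec_nth A)
  moreover have "\<forall>\<^sub>F n in sequentially. rank (transpose (A n)) = rank (transpose M)"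
    using rA by (simp add: rank_transpose)
  moreover have "transpose M *v y = 0"
    using y by simp
  ultimately obtain v where v: "v \<longlonglongrightarrow> y" "\<forall>\<^sub>F n in sequentially. transpose (A n) *v v n = 0"
    by (rule nullspace_inner_semicontinuous)
  have "\<forall>\<^sub>F n in sequentially. v n \<bullet> (S n *v u n) = 0"
    using u(2) v(2)
  proof eventually_elim
    case (elim n)
    have "0 = v n \<bullet> ((A n + t n *\<^sub>R S n) *v u n)"
      using elim(1) by simp
    also have "\<dots> = t n * (v n \<bullet> (S n *v u n))"
      using elim(2)
      by (simp add: matrix_vector_mult_add_rdistrib inner_add_right scaleR_matrix_vector_assoc[symmetric]
          dot_lmul_matrix[symmetric])
    finally show ?case using t(2) by simp
  qed
  then have "(\<lambda>n. v n \<bullet> (S n *v u n)) \<longlonglongrightarrow> 0"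
    by (rule tendsto_eventually)
  moreover have "(\<lambda>n. v n \<bullet> (S n *v u n)) \<longlonglongrightarrow> y \<bullet> (T *v x)"
    by (intro tendsto_inner tendsto_matrix_vector_mult u v S)
  ultimately show "y \<bullet> (T *v x) = 0"
    using LIMSEQ_unique by blast
qed

text \<open>The rank one matrix built from a left kernel vector and a kernel vector has a nonzero
  pairing with these two vectors. At full row rank the tangent space would be everything and the
  limit law a point mass at 0; this is the degenerate case that the null hypothesis has to
  avoid.\<close>

lemma rank_tangent_ne_UNIV:
  fixes M :: "real^'n^'m"
  assumes "rank M < CARD('m)" "rank M < CARD('n)"
  shows "rank_tangent M \<noteq> UNIV"
proof -
  obtain x where x: "x \<noteq> 0" "M *v x = 0"
    using assms(2) matrix_nonfull_linear_equations_eq[of M] by auto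
  obtain y where y: "y \<noteq> 0" "y v* M = 0"
    using assms(1) matrix_nonfull_linear_equations_eq[of "transpose M"] by (auto simp: rank_transpose)
  define T :: "real^'n^'m" where "T = (\<chi> i j. y $ i * x $ j)"
  have "T *v x = (x \<bullet> x) *\<^sub>R y"
    by (simp add: T_def matrix_vector_mult_def vec_eq_iff inner_vec_def sum_distrib_left sum_distrib_right algebra_simps)
  then have "y \<bullet> (T *v x) \<noteq> 0"
    using x y by simp
  then have "T \<notin> rank_tangent M"
    using x y by (auto simp: rank_tangent_iff)
  then show ?thesis by blast
qed

section \<open>Minimization over matrices of fixed rank\<close>

text \<open>The range grows by at most one vector, so a matrix of rank less than \<open>m\<close>
  may be moved in every coordinate direction without leaving the set of rank at most
  \<open>m\<close>.\<close>

lemma rank_add_elementary: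
  fixes A :: "real^'h^'p"
  shows "rank (A + t *\<^sub>R unvectorize (axis k 1)) \<le> rank A + 1"
proof -
  obtain j i where k: "k = (j, i)" by (cases k)
  let ?B = "A + t *\<^sub>R unvectorize (axis k 1)"
  have "unvectorize (axis k 1) *v x = x $ j *\<^sub>R axis i 1" for x :: "real^'h"
    by (auto simp: k matrix_vector_mult_def unvectorize_def axis_def vec_eq_iff
        if_distrib[where f = "\<lambda>a. a * b" for b] cong: if_cong)
  then have E: "?B *v x = A *v x + (t * x $ j) *\<^sub>R axis i 1" for x
    by (simp add: matrix_vector_mult_add_rdistrib flip: scaleR_matrix_vector_assoc)
  have "range ((*v) ?B) \<subseteq> span (insert (axis i 1) (range ((*v) A)))"
    unfolding E by (auto intro!: span_add span_scale intro: span_base)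
  then have "rank ?B \<le> dim (insert (axis i 1) (range ((*v) A)))"
    unfolding rank_dim_range by (metis dim_span dim_subset)
  also have "\<dots> \<le> rank A + 1"
    by (simp add: dim_insert rank_dim_range)
  finally show ?thesis .
qed

text \<open>A minimizer over the closed set of matrices of rank at most \<open>m\<close> has rank exactly \<open>m\<close>: otherwise
  it could be perturbed by all elementary matrices, and the first order condition would force it to
  be \<open>X\<close>.\<close>

lemma rank_argmin_exists:
  fixes X :: "real^'h^'p" and G :: "real^('h \<times> 'p)^('h \<times> 'p)"
  assumes rank: "m \<le> rank X" and c: "0 < c" and coer: "\<And>A. c * (norm A)\<^sup>2 \<le> weighted_sq G A"
  shows "\<exists>A. is_rank_argmin m G X A"
proof -
  have nonneg: "0 \<le> weighted_sq G A" for A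
    using coer[of A] c by (smt (verit) mult_nonneg_nonneg zero_le_power2)
  define f where "f A = weighted_sq G (X - A)" for A
  \<comment> \<open>Beyond this radius around \<open>X\<close>, coercivity makes \<open>f\<close>
    exceed its value at the admissible matrix 0, so the search is confined to a compact set.\<close>
  define r where "r = sqrt (f 0 / c)"
  have r: "0 \<le> r" "c * r\<^sup>2 = f 0"
    using nonneg c by (simp_all add: r_def f_def)
  let ?S = "{A. rank A \<le> m} \<inter> cball X r"
  have "norm X \<le> r"
  proof (rule power2_le_imp_le[OF _ r(1)])
    have "c * (norm X)\<^sup>2 \<le> c * r\<^sup>2"
      using coer[of X] by (simp add: r f_def)
    then show "(norm X)\<^sup>2 \<le> r\<^sup>2" using c by simp
  qed
  then have ne: "0 \<in> ?S" by simp
  have "compact ?S"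
    by (intro closed_Int_compact closed_rank_le compact_cball)
  moreover have "continuous_on ?S f"
    unfolding f_def by (intro continuous_on_compose2[OF continuous_on_weighted_sq] continuous_intros) auto
  ultimately obtain A where A: "A \<in> ?S" "\<And>B. B \<in> ?S \<Longrightarrow> f A \<le> f B"
    using continuous_attains_inf[of ?S f] ne by blast
  have min: "f A \<le> f B" if "rank B \<le> m" for B
  proof (cases "B \<in> cball X r")
    case True
    then show ?thesis using A(2) that by simp
  next
    case False
    then have "r\<^sup>2 < (norm (X - B))\<^sup>2"
      using r(1) by (intro power_strict_mono) (auto simp: dist_norm)
    then have "c * r\<^sup>2 < c * (norm (X - B))\<^sup>2"
      using c by simp
    then have "f 0 < f B"
      using coer[of "X - B"] unfolding r(2) by (simp add: f_def)
    then show ?thesis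
      using A(2)[OF ne] by simp
  qed
  have "rank A = m"
  proof (rule ccontr)
    assume "rank A \<noteq> m"
    with A(1) have less: "rank A < m" by simp
    define Y where "Y = X - A"
    define y where "y = vectorize Y"
    define S where "S = matrix_inv G"
    \<comment> \<open>The gradient of the form at \<open>y\<close>. Since \<open>S\<close> need not
      be symmetric, both it and its transpose contribute.\<close>
    define z where "z = y v* S + S *v y"
    have "z $ k = 0" for k
    proof (rule ccontr)
      assume nz: "z $ k \<noteq> 0"
      define E :: "real^'h^'p" where "E = unvectorize (axis k 1)"
      define w where "w = weighted_sq G E"
      have w: "0 \<le> w" using nonneg by (simp add: w_def)
      \<comment> \<open>With this step the change \<open>- t * z $ k + t\<^sup>2 * w\<close> equals
        \<open>- t\<^sup>2\<close>, a strict decrease.\<close>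
      define t where "t = z $ k / (w + 1)"
      have t: "z $ k = t * (w + 1)" "t \<noteq> 0"
        using w nz by (simp_all add: t_def)
      have "z $ k = z \<bullet> axis k 1"
        by (simp add: inner_axis)
      also have "\<dots> = y \<bullet> (S *v axis k 1) + axis k 1 \<bullet> (S *v y)"
        by (simp only: z_def inner_add_left dot_lmul_matrix inner_commute[of "S *v y"])
      finally have "weighted_sq G (Y - t *\<^sub>R E) = weighted_sq G Y - t * z $ k + t\<^sup>2 * w"
        unfolding w_def E_def
        by (simp add: weighted_sq_def vectorize_diff vectorize_scaleR matrix_vector_mult_diff_distrib
            matrix_vector_mult_scaleR inner_diff_left inner_diff_right power2_eq_square
            y_def[symmetric] S_def[symmetric] algebra_simps)
      also have "\<dots> = weighted_sq G Y - t\<^sup>2"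
        unfolding t(1) by (simp add: algebra_simps power2_eq_square)
      finally have "f (A + t *\<^sub>R E) < f A"
        using t(2) by (simp add: f_def Y_def algebra_simps) (smt (verit) zero_less_power2)
      moreover have "f A \<le> f (A + t *\<^sub>R E)"
        using rank_add_elementary[of A t k] less by (intro min) (simp add: E_def)
      ultimately show False by simp
    qed
    then have "z = 0" by (simp add: vec_eq_iff)
    \<comment> \<open>The left side is twice \<open>weighted_sq G Y\<close>. Hence
      \<open>Y = 0\<close> and \<open>A = X\<close>, which contradicts
      \<open>m \<le> rank X\<close>.\<close>
    then have "z \<bullet> y = 0" by simp
    then have "weighted_sq G Y = 0"
      by (simp add: z_def inner_add_left dot_lmul_matrix inner_commute[of "S *v y"] weighted_sq_def y_def[symmetric] S_def[symmetric])
    then have "Y = 0"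
      using coer[of Y] c by (simp add: mult_le_0_iff)
    then show False
      using rank less by (simp add: Y_def)
  qed
  with min show ?thesis
    by (auto simp: is_rank_argmin_def is_arg_min_def f_def not_less intro!: exI[of _ A])
qed

text \<open>As an infimum it mirrors \<open>min_rank_sq\<close> and needs no projection onto the
  tangent space; near minimizers suffice for every property below.\<close>

definition tangent_sq :: "real^('h \<times> 'p)^('h \<times> 'p) \<Rightarrow> real^'h^'p \<Rightarrow> real^'h^'p \<Rightarrow> real" where
  "tangent_sq G M Z = (INF T\<in>rank_tangent M. weighted_sq G (Z - T))"

section \<open>Convexity, homogeneity and positivity of the distance to the tangent space\<close>

context
  fixes G :: "real^('h::finite \<times> 'p::finite)^('h \<times> 'p)" and M :: "real^'h^'p"
  assumes nonneg: "\<And>A. 0 \<le> weighted_sq G A"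
begin

lemma rank_tangent_nonempty: "rank_tangent M \<noteq> {}"
  using subspace_0[OF subspace_rank_tangent] by blast

lemma tangent_sq_bdd: "bdd_below ((\<lambda>T. weighted_sq G (Z - T)) ` rank_tangent M)"
  using nonneg by (intro bdd_belowI[of _ 0]) auto

lemma tangent_sq_le: "T \<in> rank_tangent M \<Longrightarrow> tangent_sq G M Z \<le> weighted_sq G (Z - T)"
  unfolding tangent_sq_def by (intro cINF_lower tangent_sq_bdd)

lemma tangent_sq_nonneg: "0 \<le> tangent_sq G M Z"
  unfolding tangent_sq_def using nonneg by (intro cINF_greatest rank_tangent_nonempty) auto

lemma tangent_sq_lessE:
  assumes "tangent_sq G M Z < a"
  obtains T where "T \<in> rank_tangent M" "weighted_sq G (Z - T) < a"
  using assms cINF_less_iff[OF rank_tangent_nonempty tangent_sq_bdd] by (auto simp: tangent_sq_def)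

text \<open>Minimizing a jointly convex function over a subspace in one of its arguments preserves
  convexity. The slack \<open>e\<close> stands in for attained minima.\<close>

lemma convex_on_tangent_sq: "convex_on UNIV (tangent_sq G M)"
proof (rule convex_onI)
  fix t :: real and X Y assume t: "0 < t" "t < 1"
  show "tangent_sq G M ((1 - t) *\<^sub>R X + t *\<^sub>R Y) \<le> (1 - t) * tangent_sq G M X + t * tangent_sq G M Y"
  proof (rule field_le_epsilon)
    fix e :: real assume e: "0 < e"
    obtain S where S: "S \<in> rank_tangent M" "weighted_sq G (X - S) < tangent_sq G M X + e"
      using tangent_sq_lessE[of X "tangent_sq G M X + e"] e by auto
    obtain T where T: "T \<in> rank_tangent M" "weighted_sq G (Y - T) < tangent_sq G M Y + e"
      using tangent_sq_lessE[of Y "tangent_sq G M Y + e"] e by auto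
    have "tangent_sq G M ((1 - t) *\<^sub>R X + t *\<^sub>R Y)
        \<le> weighted_sq G (((1 - t) *\<^sub>R X + t *\<^sub>R Y) - ((1 - t) *\<^sub>R S + t *\<^sub>R T))"
      by (intro tangent_sq_le subspace_add subspace_scale subspace_rank_tangent S T)
    also have "\<dots> = weighted_sq G ((1 - t) *\<^sub>R (X - S) + t *\<^sub>R (Y - T))"
      by (simp add: algebra_simps)
    also have "\<dots> \<le> (1 - t) * weighted_sq G (X - S) + t * weighted_sq G (Y - T)"
      using t by (intro convex_onD[OF convex_on_weighted_sq[OF nonneg]]) auto
    also have "\<dots> \<le> (1 - t) * (tangent_sq G M X + e) + t * (tangent_sq G M Y + e)"
      using S T t by (intro add_mono mult_left_mono) auto
    finally show "tangent_sq G M ((1 - t) *\<^sub>R X + t *\<^sub>R Y)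
        \<le> (1 - t) * tangent_sq G M X + t * tangent_sq G M Y + e"
      by (simp add: algebra_simps)
  qed
qed simp

lemma continuous_on_tangent_sq: "continuous_on UNIV (tangent_sq G M)"
  by (intro convex_on_continuous convex_on_tangent_sq open_UNIV)

text \<open>The tangent space is invariant under scaling, which gives one inequality for every
  nonzero factor; applied to \<open>1 / c\<close> it gives the other.\<close>

lemma tangent_sq_scaleR: "tangent_sq G M (c *\<^sub>R Z) = c\<^sup>2 * tangent_sq G M Z"
proof (cases "c = 0")
  case True
  have "tangent_sq G M 0 \<le> 0"
    using tangent_sq_le[OF subspace_0[OF subspace_rank_tangent], of 0] by (simp add: weighted_sq_0)
  with True show ?thesis
    using tangent_sq_nonneg[of 0] by simp
next
  case False
  have le: "tangent_sq G M (c *\<^sub>R Z) \<le> c\<^sup>2 * tangent_sq G M Z" if "c \<noteq> 0" for c Z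
  proof -
    have "tangent_sq G M (c *\<^sub>R Z) / c\<^sup>2 \<le> tangent_sq G M Z"
      unfolding tangent_sq_def[of _ _ Z]
    proof (intro cINF_greatest rank_tangent_nonempty)
      fix T assume "T \<in> rank_tangent M"
      then have "tangent_sq G M (c *\<^sub>R Z) \<le> weighted_sq G (c *\<^sub>R Z - c *\<^sub>R T)"
        by (intro tangent_sq_le subspace_scale subspace_rank_tangent)
      also have "\<dots> = c\<^sup>2 * weighted_sq G (Z - T)"
        by (simp add: weighted_sq_scaleR flip: scaleR_diff_right)
      finally show "tangent_sq G M (c *\<^sub>R Z) / c\<^sup>2 \<le> weighted_sq G (Z - T)"
        using that by (simp add: field_simps)
    qed
    with that show ?thesis by (simp add: field_simps)
  qed
  have "tangent_sq G M Z \<le> (1 / c)\<^sup>2 * tangent_sq G M (c *\<^sub>R Z)"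
    using le[of "1 / c" "c *\<^sub>R Z"] False by simp
  then have "c\<^sup>2 * tangent_sq G M Z \<le> tangent_sq G M (c *\<^sub>R Z)"
    using False by (simp add: field_simps)
  with le[OF False] show ?thesis by (intro antisym)
qed

lemma tangent_sq_pos:
  assumes c: "0 < c" "\<And>A. c * (norm A)\<^sup>2 \<le> weighted_sq G A" and ne: "rank_tangent M \<noteq> UNIV"
  obtains Z where "0 < tangent_sq G M Z"
proof -
  obtain Z where "Z \<notin> rank_tangent M" using ne by blast
  moreover have "open (- rank_tangent M)"
    using closed_subspace[OF subspace_rank_tangent] by (rule open_Compl)
  ultimately obtain e where e: "0 < e" "ball Z e \<subseteq> - rank_tangent M"
    unfolding open_contains_ball by blast
  have "c * e\<^sup>2 \<le> tangent_sq G M Z"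
    unfolding tangent_sq_def
  proof (intro cINF_greatest rank_tangent_nonempty)
    fix T assume "T \<in> rank_tangent M"
    then have "e \<le> norm (Z - T)"
      using e(2) by (force simp: dist_norm)
    then have "c * e\<^sup>2 \<le> c * (norm (Z - T))\<^sup>2"
      using c(1) e(1) by (intro mult_left_mono power_mono) auto
    also have "\<dots> \<le> weighted_sq G (Z - T)" by (rule c)
    finally show "c * e\<^sup>2 \<le> weighted_sq G (Z - T)" .
  qed
  moreover have "0 < c * e\<^sup>2" using c e by simp
  ultimately show ?thesis using that[of Z] by linarith
qed

lemma min_rank_sq_le: "rank A = m \<Longrightarrow> min_rank_sq m G X \<le> weighted_sq G (X - A)"
  unfolding min_rank_sq_def using nonneg by (intro cINF_lower bdd_belowI[of _ 0]) auto

lemma min_rank_sq_lessE: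
  assumes "min_rank_sq m G (X :: real^'h^'p) < a" "rank (M0 :: real^'h^'p) = m"
  obtains A where "rank A = m" "weighted_sq G (X - A) < a"
proof -
  have "bdd_below ((\<lambda>A. weighted_sq G (X - A)) ` {A. rank A = m})"
    using nonneg by (intro bdd_belowI[of _ 0]) auto
  then show ?thesis
    using assms cINF_less_iff[of "{A. rank A = m}" "\<lambda>A. weighted_sq G (X - A)" a] that
    by (auto simp: min_rank_sq_def)
qed

end

lemma coercive_nonneg:
  assumes "0 < c" "\<And>A. c * (norm A)\<^sup>2 \<le> weighted_sq G A"
  shows "0 \<le> weighted_sq G A"
  using assms(2)[of A] assms(1) by (smt (verit) mult_nonneg_nonneg zero_le_power2)

lemma weighted_sq_nonneg:
  assumes "covariance_matrix \<Gamma>" "det \<Gamma> \<noteq> 0"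
  shows "0 \<le> weighted_sq \<Gamma> A"
  using weighted_sq_pos[OF assms, of A] by (cases "A = 0") (auto simp: weighted_sq_0)

text \<open>Upper bound: for a tangent \<open>T\<close> nearly optimal for \<open>z\<close>, a curve
  of constant rank with direction tending to \<open>T\<close> supplies competitors. Lower bound:
  write near minimizers as \<open>A + t *\<^sub>R S\<close>; coercivity bounds \<open>S\<close>, and
  any limit point of \<open>S\<close> is tangent, hence costs at least
  \<open>tangent_sq \<Gamma> M z\<close>.\<close>

lemma min_rank_sq_tendsto:
  fixes M :: "real^'h^'p" and \<Gamma> :: "real^('h \<times> 'p)^('h \<times> 'p)"
  assumes cov: "covariance_matrix \<Gamma>" and det: "det \<Gamma> \<noteq> 0"
    and A: "A \<longlonglongrightarrow> M" and rank: "\<And>n. rank (A n) = rank M"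
    and t: "t \<longlonglongrightarrow> 0" "\<And>n. 0 < t n"
    and Z: "Z \<longlonglongrightarrow> z" and G: "G \<longlonglongrightarrow> \<Gamma>"
  shows "(\<lambda>n. min_rank_sq (rank M) (G n) (A n + t n *\<^sub>R Z n) / (t n)\<^sup>2) \<longlonglongrightarrow> tangent_sq \<Gamma> M z"
    (is "?f \<longlonglongrightarrow> ?L")
proof -
  obtain c C where c: "0 < c" "0 < C" and
    ev: "\<forall>\<^sub>F G in nhds \<Gamma>. \<forall>A. c * (norm A)\<^sup>2 \<le> weighted_sq G A \<and> weighted_sq G A \<le> C * (norm A)\<^sup>2"
    by (rule weighted_sq_bounds[OF cov det])
  note nonneg = weighted_sq_nonneg[OF cov det]
  have coer: "\<forall>\<^sub>F n in sequentially. \<forall>A. c * (norm A)\<^sup>2 \<le> weighted_sq (G n) A"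
    using eventually_compose_filterlim[OF ev G] by (auto elim: eventually_mono)
  have scale: "weighted_sq H (B + s *\<^sub>R X - (B + s *\<^sub>R Y)) / s\<^sup>2 = weighted_sq H (X - Y)"
    if "0 < s" for H :: "real^('h \<times> 'p)^('h \<times> 'p)" and B X Y s
    using that by (simp add: weighted_sq_scaleR flip: scaleR_diff_right)
  show ?thesis
  proof (rule order_tendstoI)
    fix a assume a: "?L < a"
    then obtain T where T: "T \<in> rank_tangent M" "weighted_sq \<Gamma> (z - T) < a"
      using tangent_sq_lessE[OF nonneg] by blast
    obtain S where S: "S \<longlonglongrightarrow> T" "\<forall>\<^sub>F n in sequentially. rank (A n + t n *\<^sub>R S n) = rank (A n)"
      using rank_tangent_approx[OF A t(1) T(1)] .
    have "(\<lambda>n. weighted_sq (G n) (Z n - S n)) \<longlonglongrightarrow> weighted_sq \<Gamma> (z - T)"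
      by (intro tendsto_weighted_sq G det tendsto_diff Z S)
    then have "\<forall>\<^sub>F n in sequentially. weighted_sq (G n) (Z n - S n) < a"
      using T(2) by (rule order_tendstoD)
    with S(2) coer show "\<forall>\<^sub>F n in sequentially. ?f n < a"
    proof eventually_elim
      case (elim n)
      have "min_rank_sq (rank M) (G n) (A n + t n *\<^sub>R Z n)
          \<le> weighted_sq (G n) (A n + t n *\<^sub>R Z n - (A n + t n *\<^sub>R S n))"
        using elim c rank by (intro min_rank_sq_le coercive_nonneg[of c]) auto
      then have "?f n \<le> weighted_sq (G n) (Z n - S n)"
        by (subst scale[OF t(2)[of n], of "G n" "A n" "Z n" "S n", symmetric]) (rule divide_right_mono, simp_all)
      with elim show ?case by simp
    qed
  next
    fix a assume a: "a < ?L"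
    show "\<forall>\<^sub>F n in sequentially. a < ?f n"
    proof (rule ccontr)
      assume "\<not> ?thesis"
      \<comment> \<open>Coercivity holds only eventually. Folding it into the negated claim yields a
        subsequence along which it holds at every index.\<close>
      then have "\<not> (\<forall>\<^sub>F n in sequentially. (\<forall>A. c * (norm A)\<^sup>2 \<le> weighted_sq (G n) A) \<longrightarrow> a < ?f n)"
        by (rule contrapos_nn) (rule eventually_mp[OF _ coer])
      from not_eventually_sequentiallyD[OF this] obtain r :: "nat \<Rightarrow> nat" where r: "strict_mono r"
        and rc: "\<And>n A. c * (norm A)\<^sup>2 \<le> weighted_sq (G (r n)) A" and ra: "\<And>n. ?f (r n) \<le> a"
        unfolding not_imp not_less by blast
      \<comment> \<open>The infimum need not be attained. A level strictly above \<open>a\<close>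
        admits near minimizers, and staying below \<open>?L\<close> preserves the
        contradiction.\<close>
      define b where "b = (a + ?L) / 2"
      have b: "a < b" "b < ?L" using a by (simp_all add: b_def)
      have "\<exists>B. rank B = rank M \<and> weighted_sq (G (r n)) (A (r n) + t (r n) *\<^sub>R Z (r n) - B) < b * (t (r n))\<^sup>2" for n
      proof -
        have "min_rank_sq (rank M) (G (r n)) (A (r n) + t (r n) *\<^sub>R Z (r n)) \<le> a * (t (r n))\<^sup>2"
          using ra[of n] t(2)[of "r n"] by (simp add: field_simps)
        also have "\<dots> < b * (t (r n))\<^sup>2"
          using b t(2)[of "r n"] by simp
        finally show ?thesis
          by (rule min_rank_sq_lessE[OF coercive_nonneg[OF c(1) rc] _ refl]) blast
      qed
      then obtain B where B: "\<And>n. rank (B n) = rank M"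
        "\<And>n. weighted_sq (G (r n)) (A (r n) + t (r n) *\<^sub>R Z (r n) - B n) < b * (t (r n))\<^sup>2"
        by metis
      define S where "S n = (1 / t (r n)) *\<^sub>R (B n - A (r n))" for n
      have B_eq: "B n = A (r n) + t (r n) *\<^sub>R S n" for n
        using t(2)[of "r n"] by (simp add: S_def)
      have Sb: "weighted_sq (G (r n)) (Z (r n) - S n) < b" for n
        using B(2)[of n] t(2)[of "r n"] scale[OF t(2)[of "r n"], of "G (r n)" "A (r n)" "Z (r n)" "S n"]
        unfolding B_eq by (metis pos_divide_less_eq zero_less_power)
      have Zr: "(\<lambda>n. Z (r n)) \<longlonglongrightarrow> z"
        using LIMSEQ_subseq_LIMSEQ[OF Z r] by (simp add: o_def)
      obtain K where K: "\<And>n. norm (Z (r n)) \<le> K"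
        using convergent_imp_bounded[OF Zr] by (auto simp: bounded_iff)
      \<comment> \<open>The term \<open>sqrt (b / c)\<close> is the coercivity bound on the distance
        from \<open>Z (r n)\<close> to \<open>S n\<close>.\<close>
      have "norm (S n) \<le> K + sqrt (b / c)" for n
      proof -
        have "(norm (Z (r n) - S n))\<^sup>2 \<le> b / c"
          using rc[of "Z (r n) - S n" n] Sb[of n] c by (simp add: field_simps)
        then have "norm (Z (r n) - S n) \<le> sqrt (b / c)"
          by (rule real_le_rsqrt)
        then show ?thesis
          using K[of n] norm_triangle_sub[of "S n" "Z (r n)"] by (simp add: norm_minus_commute)
      qed
      then have "bounded (range S)" by (auto simp: bounded_iff)
      then obtain T s where s: "strict_mono s" and ST: "(S \<circ> s) \<longlonglongrightarrow> T"
        using bounded_imp_convergent_subsequence by blast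
      have rs: "strict_mono (r \<circ> s)" using r s by (rule strict_mono_o)
      have "(A \<circ> (r \<circ> s)) \<longlonglongrightarrow> M" "(t \<circ> (r \<circ> s)) \<longlonglongrightarrow> 0" and GZ: "(G \<circ> (r \<circ> s)) \<longlonglongrightarrow> \<Gamma>" "(Z \<circ> (r \<circ> s)) \<longlonglongrightarrow> z"
        using LIMSEQ_subseq_LIMSEQ[OF _ rs] A t(1) G Z by blast+
      then have T: "T \<in> rank_tangent M"
        using B(1) t(2) rank
        by (intro rank_tangent_limit[OF _ _ _ _ ST, of "A \<circ> (r \<circ> s)" M "t \<circ> (r \<circ> s)"])
          (auto simp: B_eq less_imp_neq[symmetric])
      have "(\<lambda>n. weighted_sq ((G \<circ> (r \<circ> s)) n) ((Z \<circ> (r \<circ> s)) n - (S \<circ> s) n)) \<longlonglongrightarrow> weighted_sq \<Gamma> (z - T)"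
        by (intro tendsto_weighted_sq GZ det tendsto_diff ST)
      then have "weighted_sq \<Gamma> (z - T) \<le> b"
        by (rule LIMSEQ_le_const2) (auto intro!: exI less_imp_le Sb)
      then show False
        using tangent_sq_le[OF nonneg T, of z] b by linarith
    qed
  qed
qed

text \<open>Convergence along all sequences gives uniformity: a failure for every
  \<open>d = 1 / Suc n\<close> would provide sequences of counterexamples, and boundedness of
  \<open>Z\<close> lets a subsequence contradict \<open>min_rank_sq_tendsto\<close>. The uniform
  form makes it possible to argue on events of large probability instead of through an almost sure
  representation of convergence in law.\<close>

lemma min_rank_sq_uniform:
  fixes M :: "real^'h^'p" and \<Gamma> :: "real^('h \<times> 'p)^('h \<times> 'p)"
  assumes cov: "covariance_matrix \<Gamma>" and det: "det \<Gamma> \<noteq> 0" and e: "0 < e"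
  obtains d where "0 < d"
    "\<And>t A G Z. 0 < t \<Longrightarrow> t < d \<Longrightarrow> rank A = rank M \<Longrightarrow> norm (A - M) < d \<Longrightarrow> norm (G - \<Gamma>) < d \<Longrightarrow>
      norm Z \<le> R \<Longrightarrow> \<bar>min_rank_sq (rank M) G (A + t *\<^sub>R Z) / t\<^sup>2 - tangent_sq \<Gamma> M Z\<bar> < e"
proof -
  have "\<exists>d>0. \<forall>t A G Z. 0 < t \<longrightarrow> t < d \<longrightarrow> rank A = rank M \<longrightarrow> norm (A - M) < d \<longrightarrow> norm (G - \<Gamma>) < d \<longrightarrow>
      norm Z \<le> R \<longrightarrow> \<bar>min_rank_sq (rank M) G (A + t *\<^sub>R Z) / t\<^sup>2 - tangent_sq \<Gamma> M Z\<bar> < e"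
  proof (rule ccontr)
    assume contra: "\<not> ?thesis"
    have "\<exists>t A G Z. 0 < t \<and> t < 1 / real (Suc n) \<and> rank A = rank M \<and> norm (A - M) < 1 / real (Suc n) \<and>
        norm (G - \<Gamma>) < 1 / real (Suc n) \<and> norm Z \<le> R \<and>
        e \<le> \<bar>min_rank_sq (rank M) G (A + t *\<^sub>R Z) / t\<^sup>2 - tangent_sq \<Gamma> M Z\<bar>" for n
      using contra[unfolded not_ex, rule_format, of "1 / real (Suc n)"] by (auto simp: not_less)
    then obtain t A G Z where t: "\<And>n. 0 < t n" "\<And>n. t n < 1 / real (Suc n)"
      and A: "\<And>n. rank (A n) = rank M" "\<And>n. norm (A n - M) < 1 / real (Suc n)"
      and G: "\<And>n. norm (G n - \<Gamma>) < 1 / real (Suc n)" and Z: "\<And>n. norm (Z n) \<le> R"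
      and ge: "\<And>n. e \<le> \<bar>min_rank_sq (rank M) (G n) (A n + t n *\<^sub>R Z n) / (t n)\<^sup>2 - tangent_sq \<Gamma> M (Z n)\<bar>"
      by metis
    have "bounded (range Z)" using Z by (auto simp: bounded_iff)
    then obtain z r where r: "strict_mono r" and Zr: "(Z \<circ> r) \<longlonglongrightarrow> z"
      using bounded_imp_convergent_subsequence by blast
    have null: "(\<lambda>n. 1 / real (Suc n)) \<longlonglongrightarrow> 0"
      using LIMSEQ_inverse_real_of_nat by (simp add: inverse_eq_divide)
    have "t \<longlonglongrightarrow> 0"
      by (rule Lim_null_comparison[OF _ null]) (use t in \<open>auto intro!: always_eventually less_imp_le simp: abs_of_pos\<close>)
    moreover have "(\<lambda>n. A n - M) \<longlonglongrightarrow> 0" "(\<lambda>n. G n - \<Gamma>) \<longlonglongrightarrow> 0"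
      by (rule Lim_null_comparison[OF _ null], use A G in \<open>auto intro!: always_eventually less_imp_le\<close>)+
    then have "A \<longlonglongrightarrow> M" "G \<longlonglongrightarrow> \<Gamma>"
      by (simp_all add: LIM_zero_iff)
    ultimately have lims: "(t \<circ> r) \<longlonglongrightarrow> 0" "(A \<circ> r) \<longlonglongrightarrow> M" "(G \<circ> r) \<longlonglongrightarrow> \<Gamma>"
      using LIMSEQ_subseq_LIMSEQ[OF _ r] by blast+
    have "(\<lambda>n. min_rank_sq (rank M) ((G \<circ> r) n) ((A \<circ> r) n + (t \<circ> r) n *\<^sub>R (Z \<circ> r) n) / ((t \<circ> r) n)\<^sup>2)
        \<longlonglongrightarrow> tangent_sq \<Gamma> M z"
      by (intro min_rank_sq_tendsto cov det lims Zr) (use A t in auto)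
    moreover have "(\<lambda>n. tangent_sq \<Gamma> M ((Z \<circ> r) n)) \<longlonglongrightarrow> tangent_sq \<Gamma> M z"
      by (intro continuous_on_tendsto_compose[OF continuous_on_tangent_sq Zr])
        (auto simp: weighted_sq_nonneg[OF cov det])
    ultimately have "(\<lambda>n. \<bar>min_rank_sq (rank M) ((G \<circ> r) n) ((A \<circ> r) n + (t \<circ> r) n *\<^sub>R (Z \<circ> r) n) / ((t \<circ> r) n)\<^sup>2
        - tangent_sq \<Gamma> M ((Z \<circ> r) n)\<bar>) \<longlonglongrightarrow> \<bar>tangent_sq \<Gamma> M z - tangent_sq \<Gamma> M z\<bar>"
      by (intro tendsto_rabs tendsto_diff)
    then have "e \<le> \<bar>tangent_sq \<Gamma> M z - tangent_sq \<Gamma> M z\<bar>"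
      by (rule LIMSEQ_le_const) (use ge in auto)
    with e show False by simp
  qed
  then show ?thesis using that by blast
qed

section \<open>Measurability and convergence in law\<close>

lemma borel_measurable_weighted_sq:
  fixes X :: "'a \<Rightarrow> real^'h^'p"
  assumes [measurable]: "G \<in> borel_measurable M" "X \<in> borel_measurable M"
  shows "(\<lambda>\<omega>. weighted_sq (G \<omega>) (X \<omega>)) \<in> borel_measurable M"
proof -
  have "continuous_on UNIV (\<lambda>x :: (real^('h \<times> 'p)^('h \<times> 'p)) \<times> (real^'h^'p).
      vectorize (snd x) \<bullet> (fst x *v vectorize (snd x)))"
    unfolding continuous_on_def
    by (intro ballI tendsto_inner tendsto_matrix_vector_mult tendsto_vectorize tendsto_fst tendsto_snd
        tendsto_ident_at)
  then show ?thesis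
    unfolding weighted_sq_def
    by (intro borel_measurable_continuous_Pair[where H = "\<lambda>S A. vectorize A \<bullet> (S *v vectorize A)"])
      simp_all
qed

text \<open>The infimum of a set of reals, even of an unbounded one, depends on its lower bounds only;
  hence a countable dense subset of the index set suffices.\<close>

lemma min_rank_sq_countable:
  obtains D :: "(real^'h^'p) set" where "countable D"
    "\<And>(G :: real^('h \<times> 'p)^('h \<times> 'p)) X. min_rank_sq m G X = (INF A\<in>D. weighted_sq G (X - A))"
proof -
  obtain D :: "(real^'h^'p) set" where D: "countable D" "D \<subseteq> {A. rank A = m}" "{A. rank A = m} \<subseteq> closure D"
    using separable .
  have Inf_cong: "Inf S = Inf T" if "\<And>z. (\<forall>x\<in>S. z \<le> x) \<longleftrightarrow> (\<forall>x\<in>T. z \<le> x)" for S T :: "real set"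
  proof -
    have "(\<forall>x\<in>uminus ` S. x \<le> z) \<longleftrightarrow> (\<forall>x\<in>uminus ` T. x \<le> z)" for z
      using that[of "- z"] by (auto simp: minus_le_iff)
    then show ?thesis
      unfolding Inf_real_def Sup_real_def by simp
  qed
  have "min_rank_sq m G X = (INF A\<in>D. weighted_sq G (X - A))"
    for G :: "real^('h \<times> 'p)^('h \<times> 'p)" and X
    unfolding min_rank_sq_def
  proof (rule Inf_cong)
    fix z
    let ?C = "{A. z \<le> weighted_sq G (X - A)}"
    have "closed ?C"
      by (intro closed_Collect_le continuous_on_compose2[OF continuous_on_weighted_sq] continuous_intros) auto
    then have "D \<subseteq> ?C \<Longrightarrow> closure D \<subseteq> ?C"
      by (rule closure_minimal[rotated])
    with D show "(\<forall>x\<in>(\<lambda>A. weighted_sq G (X - A)) ` {A. rank A = m}. z \<le> x) \<longleftrightarrow>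
        (\<forall>x\<in>(\<lambda>A. weighted_sq G (X - A)) ` D. z \<le> x)"
      by blast
  qed
  with D(1) show ?thesis by (rule that)
qed

lemma borel_measurable_min_rank_sq [measurable]:
  fixes X :: "'a \<Rightarrow> real^'h^'p"
  assumes [measurable]: "G \<in> borel_measurable M" "X \<in> borel_measurable M"
  shows "(\<lambda>\<omega>. min_rank_sq m (G \<omega>) (X \<omega>)) \<in> borel_measurable M"
proof -
  obtain D :: "(real^'h^'p) set" where D: "countable D"
    "\<And>(G :: real^('h \<times> 'p)^('h \<times> 'p)) X. min_rank_sq m G X = (INF A\<in>D. weighted_sq G (X - A))"
    by (rule min_rank_sq_countable[of m]) blast
  show ?thesis
    unfolding D(2)
    by (intro borel_measurable_cINF_real D(1) borel_measurable_weighted_sq) measurable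
qed

text \<open>Right continuity of the distribution function makes the infimum a minimum, and a level
  strictly between 0 and 1 makes the set nonempty and bounded below. The equivalence reduces
  measurability, convergence and boundedness of quantiles to statements about distribution
  functions.\<close>

lemma (in real_distribution) quantile_le_iff:
  assumes \<alpha>: "0 < \<alpha>" "\<alpha> < 1"
  shows "quantile M \<alpha> \<le> x \<longleftrightarrow> \<alpha> \<le> cdf M x"
proof -
  let ?S = "{x. \<alpha> \<le> cdf M x}"
  obtain a where a: "cdf M a < \<alpha>"
    using eventually_happens'[OF trivial_limit_at_bot_linorder order_tendstoD(2)[OF cdf_lim_at_bot \<alpha>(1)]] by blast
  have bdd: "bdd_below ?S"
  proof (rule bdd_belowI)
    fix y assume "y \<in> ?S"
    then show "a \<le> y"
      using a cdf_nondecreasing[of y a] by (cases "a \<le> y") auto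
  qed
  obtain b where "\<alpha> < cdf M b"
    using eventually_happens'[OF trivial_limit_at_top_linorder order_tendstoD(1)[OF cdf_lim_at_top_prob \<alpha>(2)]] by blast
  then have ne: "?S \<noteq> {}" by (auto intro: less_imp_le)
  show ?thesis
  proof
    assume le: "quantile M \<alpha> \<le> x"
    show "\<alpha> \<le> cdf M x"
    proof (rule ccontr)
      assume less: "\<not> ?thesis"
      have "(cdf M \<longlongrightarrow> cdf M x) (at_right x)"
        using cdf_is_right_cont by (simp add: continuous_within)
      with less have "\<forall>\<^sub>F y in at_right x. cdf M y < \<alpha>"
        by (intro order_tendstoD) auto
      then obtain b where b: "x < b" "\<And>y. x < y \<Longrightarrow> y < b \<Longrightarrow> cdf M y < \<alpha>"
        by (auto simp: eventually_at_right_field)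
      have "b \<le> y" if "y \<in> ?S" for y
        using b(2)[of y] that less cdf_nondecreasing[of y x] by force
      then have "b \<le> quantile M \<alpha>"
        unfolding quantile_def by (intro cInf_greatest ne)
      with b(1) le show False by simp
    qed
  next
    assume "\<alpha> \<le> cdf M x"
    then show "quantile M \<alpha> \<le> x"
      unfolding quantile_def using bdd by (intro cInf_lower) auto
  qed
qed

text \<open>Sublevel sets of the quantile are superlevel sets of the conditional probability that
  \<open>Y \<omega>\<close> is at most \<open>x\<close>, which depends measurably on the sample
  because \<open>K\<close> is a kernel. Without this the rejection event could fail to be
  measurable.\<close>

lemma borel_measurable_quantile_kernel:
  assumes K: "K \<in> measurable P (prob_algebra B)"
    and Y: "(\<lambda>(\<omega>, b). Y \<omega> b) \<in> borel_measurable (P \<Otimes>\<^sub>M B)"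
    and \<alpha>: "0 < \<alpha>" "\<alpha> < 1"
  shows "(\<lambda>\<omega>. quantile (distr (K \<omega>) borel (Y \<omega>)) \<alpha>) \<in> borel_measurable P"
proof (rule borel_measurableI_le)
  fix x
  have Ysec: "Y \<omega> \<in> borel_measurable (K \<omega>)" and prob: "prob_space (K \<omega>)" if "\<omega> \<in> space P" for \<omega>
  proof -
    have "K \<omega> \<in> space (prob_algebra B)"
      using measurable_space[OF K that] .
    then show "prob_space (K \<omega>)" and "Y \<omega> \<in> borel_measurable (K \<omega>)"
      using measurable_compose[OF measurable_Pair1'[OF that] Y]
      by (simp_all add: space_prob_algebra cong: measurable_cong_sets)
  qed
  have S: "(SIGMA \<omega>:space P. {b \<in> space B. Y \<omega> b \<le> x}) \<in> sets (P \<Otimes>\<^sub>M B)"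
  proof -
    have "{z \<in> space (P \<Otimes>\<^sub>M B). (\<lambda>(\<omega>, b). Y \<omega> b) z \<le> x} \<in> sets (P \<Otimes>\<^sub>M B)"
      using Y by (rule borel_measurable_le[OF _ borel_measurable_const])
    also have "{z \<in> space (P \<Otimes>\<^sub>M B). (\<lambda>(\<omega>, b). Y \<omega> b) z \<le> x} =
        (SIGMA \<omega>:space P. {b \<in> space B. Y \<omega> b \<le> x})"
      by (auto simp: space_pair_measure)
    finally show ?thesis .
  qed
  have [measurable]: "(\<lambda>\<omega>. measure (K \<omega>) {b \<in> space B. Y \<omega> b \<le> x}) \<in> borel_measurable P"
    by (rule measure_measurable_subprob_algebra2[OF S measurable_prob_algebraD[OF K]])
  have "quantile (distr (K \<omega>) borel (Y \<omega>)) \<alpha> \<le> x \<longleftrightarrow> \<alpha> \<le> measure (K \<omega>) {b \<in> space B. Y \<omega> b \<le> x}"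
    if "\<omega> \<in> space P" for \<omega>
  proof -
    have "K \<omega> \<in> space (prob_algebra B)"
      using measurable_space[OF K that] .
    then have sp: "space (K \<omega>) = space B"
      by (auto simp: space_prob_algebra dest: sets_eq_imp_space_eq)
    interpret prob_space "K \<omega>" by (rule prob[OF that])
    interpret D: real_distribution "distr (K \<omega>) borel (Y \<omega>)"
      by (rule real_distribution_distr[OF Ysec[OF that]])
    have "cdf (distr (K \<omega>) borel (Y \<omega>)) x = measure (K \<omega>) {b \<in> space B. Y \<omega> b \<le> x}"
      unfolding cdf_def2 using Ysec[OF that]
      by (subst measure_distr) (auto simp flip: sp intro!: arg_cong[where f = "measure (K \<omega>)"])
    then show ?thesis
      using D.quantile_le_iff[OF \<alpha>] by simp
  qed
  then have "{\<omega> \<in> space P. quantile (distr (K \<omega>) borel (Y \<omega>)) \<alpha> \<le> x} =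
      {\<omega> \<in> space P. \<alpha> \<le> measure (K \<omega>) {b \<in> space B. Y \<omega> b \<le> x}}"
    by auto
  also have "\<dots> \<in> sets P" by measurable
  finally show "{\<omega> \<in> space P. quantile (distr (K \<omega>) borel (Y \<omega>)) \<alpha> \<le> x} \<in> sets P" .
qed

text \<open>Continuous mapping and Slutsky's lemma in one statement. The spaces \<open>P n\<close>
  may vary, so that it serves both for the sample and for the conditional laws at a fixed sample
  point.\<close>

lemma converges_in_law_cdf:
  fixes \<Phi> :: "'e::topological_space \<Rightarrow> real"
  assumes P: "\<And>n. prob_space (P n)" and X: "\<And>n. X n \<in> borel_measurable (P n)"
    and Y: "\<And>n. Y n \<in> borel_measurable (P n)"
    and Q: "prob_space Q" and W: "W \<in> borel_measurable Q"
    and law: "converges_in_law P X Q W" and \<Phi>: "continuous_on UNIV \<Phi>"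
    and appr: "converges_in_prob P (\<lambda>n \<omega>. Y n \<omega> - \<Phi> (X n \<omega>)) 0"
    and cont: "isCont (cdf (distr Q borel (\<lambda>x. \<Phi> (W x)))) c"
  shows "(\<lambda>n. cdf (distr (P n) borel (Y n)) c) \<longlonglongrightarrow> cdf (distr Q borel (\<lambda>x. \<Phi> (W x))) c"
proof -
  have [measurable]: "\<Phi> \<in> borel_measurable borel"
    using \<Phi> by (rule borel_measurable_continuous_onI)
  note [measurable] = X Y W
  have "weak_conv_m (\<lambda>n. distr (P n) borel (Y n)) (distr Q borel (\<lambda>x. \<Phi> (W x)))"
  proof (rule integral_cts_step_conv_imp_weak_conv)
    show "real_distribution (distr (P n) borel (Y n))" for n
      using prob_space.real_distribution_distr[OF P] Y by blast
    show "real_distribution (distr Q borel (\<lambda>x. \<Phi> (W x)))"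
      by (intro prob_space.real_distribution_distr[OF Q]) measurable
    fix x y :: real assume xy: "x < y"
    let ?f = "cts_step x y"
    have uc: "uniformly_continuous_on UNIV ?f"
      using xy by (rule cts_step_uniformly_continuous)
    have [measurable]: "?f \<in> borel_measurable borel"
      using uniformly_continuous_imp_continuous[OF uc] by (rule borel_measurable_continuous_onI)
    have f01: "0 \<le> ?f z" "?f z \<le> 1" for z
      using xy by (auto simp: cts_step_def)
    have int: "integrable (P n) (\<lambda>\<omega>. ?f (g \<omega>))" if [measurable]: "g \<in> borel_measurable (P n)" for n g
    proof -
      interpret prob_space "P n" by (rule P)
      show ?thesis
        by (rule integrable_const_bound[of _ 1]) (use f01 in auto)
    qed
    have 1: "(\<lambda>n. \<integral>\<omega>. ?f (\<Phi> (X n \<omega>)) \<partial>P n) \<longlonglongrightarrow> (\<integral>\<omega>. ?f (\<Phi> (W \<omega>)) \<partial>Q)"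
    proof -
      have "continuous_on UNIV (\<lambda>z. ?f (\<Phi> z))"
        by (intro continuous_on_compose2[OF uniformly_continuous_imp_continuous[OF uc] \<Phi>]) auto
      moreover have "bounded (range (\<lambda>z. ?f (\<Phi> z)))"
        using f01 by (auto simp: bounded_iff intro!: exI[of _ 1])
      ultimately show ?thesis
        using law unfolding converges_in_law_def by blast
    qed
    \<comment> \<open>By uniform continuity the integrands differ by less than \<open>e / 2\<close>
      off an event of probability less than \<open>e / 2\<close>, and by at most 1 on it.\<close>
    have 2: "(\<lambda>n. (\<integral>\<omega>. ?f (Y n \<omega>) \<partial>P n) - (\<integral>\<omega>. ?f (\<Phi> (X n \<omega>)) \<partial>P n)) \<longlonglongrightarrow> 0"
    proof (rule LIMSEQ_I, simp)
      fix e :: real assume e: "0 < e"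
      obtain d where d: "0 < d" "\<And>a b. dist a b < d \<Longrightarrow> dist (?f a) (?f b) < e / 2"
        using uc[unfolded uniformly_continuous_on_def, rule_format, OF half_gt_zero[OF e]]
        by (auto simp: dist_commute)
      have "(\<lambda>n. measure (P n) {\<omega> \<in> space (P n). d / 2 < dist (Y n \<omega> - \<Phi> (X n \<omega>)) 0}) \<longlonglongrightarrow> 0"
        using appr[unfolded converges_in_prob_def, rule_format, OF half_gt_zero[OF d(1)]] .
      then have "\<forall>\<^sub>F n in sequentially. measure (P n) {\<omega> \<in> space (P n). d / 2 < dist (Y n \<omega> - \<Phi> (X n \<omega>)) 0} < e / 2"
        using e by (intro order_tendstoD) auto
      then have "\<forall>\<^sub>F n in sequentially. \<bar>(\<integral>\<omega>. ?f (Y n \<omega>) \<partial>P n) - (\<integral>\<omega>. ?f (\<Phi> (X n \<omega>)) \<partial>P n)\<bar> < e"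
      proof eventually_elim
        case (elim n)
        interpret prob_space "P n" by (rule P)
        let ?A = "{\<omega> \<in> space (P n). d / 2 < dist (Y n \<omega> - \<Phi> (X n \<omega>)) 0}"
        have A [measurable]: "?A \<in> sets (P n)" by measurable
        have "\<bar>(\<integral>\<omega>. ?f (Y n \<omega>) \<partial>P n) - (\<integral>\<omega>. ?f (\<Phi> (X n \<omega>)) \<partial>P n)\<bar> =
            \<bar>\<integral>\<omega>. ?f (Y n \<omega>) - ?f (\<Phi> (X n \<omega>)) \<partial>P n\<bar>"
          by (subst Bochner_Integration.integral_diff) (auto intro!: int)
        also have "\<dots> \<le> (\<integral>\<omega>. \<bar>?f (Y n \<omega>) - ?f (\<Phi> (X n \<omega>))\<bar> \<partial>P n)"
          by (rule integral_abs_bound)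
        also have "\<dots> \<le> (\<integral>\<omega>. e / 2 + indicator ?A \<omega> \<partial>P n)"
        proof (rule integral_mono)
          show "integrable (P n) (\<lambda>\<omega>. \<bar>?f (Y n \<omega>) - ?f (\<Phi> (X n \<omega>))\<bar>)"
            by (intro integrable_abs Bochner_Integration.integrable_diff int) measurable
          show "integrable (P n) (\<lambda>\<omega>. e / 2 + indicator ?A \<omega>)"
            by (intro Bochner_Integration.integrable_add) (auto simp: emeasure_eq_measure)
          fix \<omega> assume \<omega>: "\<omega> \<in> space (P n)"
          show "\<bar>?f (Y n \<omega>) - ?f (\<Phi> (X n \<omega>))\<bar> \<le> e / 2 + indicator ?A \<omega>"
          proof (cases "\<omega> \<in> ?A")
            case True
            have "\<bar>?f (Y n \<omega>) - ?f (\<Phi> (X n \<omega>))\<bar> \<le> 1"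
              using f01[of "Y n \<omega>"] f01[of "\<Phi> (X n \<omega>)"] by linarith
            with True e show ?thesis by simp
          next
            case False
            then have "dist (Y n \<omega>) (\<Phi> (X n \<omega>)) < d"
              using \<omega> d(1) by (auto simp: dist_real_def)
            from d(2)[OF this] False show ?thesis
              by (simp add: dist_real_def)
          qed
        qed
        also have "\<dots> = e / 2 + prob ?A"
          by (subst Bochner_Integration.integral_add) (auto simp: prob_space emeasure_eq_measure)
        also have "\<dots> < e" using elim by simp
        finally show ?case .
      qed
      then show "\<exists>no. \<forall>n\<ge>no. \<bar>(\<integral>\<omega>. ?f (Y n \<omega>) \<partial>P n) - (\<integral>\<omega>. ?f (\<Phi> (X n \<omega>)) \<partial>P n)\<bar> < e"
        by (simp add: eventually_sequentially)
    qed
    have "(\<lambda>n. \<integral>\<omega>. ?f (Y n \<omega>) \<partial>P n) \<longlonglongrightarrow> (\<integral>\<omega>. ?f (\<Phi> (W \<omega>)) \<partial>Q)"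
      using tendsto_add[OF 1 2] by simp
    then show "(\<lambda>n. integral\<^sup>L (distr (P n) borel (Y n)) ?f) \<longlonglongrightarrow> integral\<^sup>L (distr Q borel (\<lambda>x. \<Phi> (W x))) ?f"
      by (simp add: integral_distr)
  qed
  then show ?thesis
    using cont by (simp add: weak_conv_m_def weak_conv_def)
qed

lemma converges_in_law_tight:
  fixes X :: "nat \<Rightarrow> 'a \<Rightarrow> 'e::euclidean_space"
  assumes P: "\<And>n. prob_space (P n)" and X: "\<And>n. X n \<in> borel_measurable (P n)"
    and Q: "prob_space Q" and W: "W \<in> borel_measurable Q"
    and law: "converges_in_law P X Q W" and e: "0 < e"
  obtains R where "\<forall>\<^sub>F n in sequentially. measure (P n) {\<omega> \<in> space (P n). R < norm (X n \<omega>)} < e"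
proof -
  interpret Q: prob_space Q by (rule Q)
  note [measurable] = X W
  have "(\<lambda>k. measure Q {x \<in> space Q. real k < norm (W x)}) \<longlonglongrightarrow> measure Q (\<Inter>k. {x \<in> space Q. real k < norm (W x)})"
    by (rule Q.finite_Lim_measure_decseq) (auto simp: decseq_def)
  also have "(\<Inter>k. {x \<in> space Q. real k < norm (W x)}) = {}"
    using reals_Archimedean2 by (auto dest: less_asym)
  finally have "\<forall>\<^sub>F k in sequentially. measure Q {x \<in> space Q. real k < norm (W x)} < e"
    using e by (intro order_tendstoD) auto
  then obtain k where k: "measure Q {x \<in> space Q. real k < norm (W x)} < e"
    using eventually_happens'[OF sequentially_bot] by blast
  \<comment> \<open>A continuous cutoff between the indicators of norm larger than
    \<open>k + 1\<close> and of norm larger than \<open>k\<close>; this is why the final radius is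
    \<open>k + 1\<close>.\<close>
  define f where "f x = min 1 (max 0 (norm x - real k))" for x :: 'e
  have f: "continuous_on UNIV f"
    unfolding f_def by (intro continuous_intros)
  have [measurable]: "f \<in> borel_measurable borel"
    using f by (rule borel_measurable_continuous_onI)
  have f01: "0 \<le> f x" "f x \<le> 1" for x
    by (auto simp: f_def)
  then have "(\<lambda>n. \<integral>\<omega>. f (X n \<omega>) \<partial>P n) \<longlonglongrightarrow> (\<integral>\<omega>. f (W \<omega>) \<partial>Q)"
    using law f unfolding converges_in_law_def by (auto simp: bounded_iff intro!: exI[of _ 1])
  moreover have "(\<integral>\<omega>. f (W \<omega>) \<partial>Q) < e"
  proof -
    have "(\<integral>\<omega>. f (W \<omega>) \<partial>Q) \<le> (\<integral>\<omega>. indicator {x \<in> space Q. real k < norm (W x)} \<omega> \<partial>Q)"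
    proof (rule integral_mono)
      show "integrable Q (\<lambda>\<omega>. f (W \<omega>))"
        by (rule Q.integrable_const_bound[of _ 1]) (use f01 in auto)
      show "integrable Q (indicator {x \<in> space Q. real k < norm (W x)} :: _ \<Rightarrow> real)"
        by (auto simp: Q.emeasure_eq_measure)
    qed (auto simp: f_def indicator_def)
    with k show ?thesis by simp
  qed
  ultimately have "\<forall>\<^sub>F n in sequentially. (\<integral>\<omega>. f (X n \<omega>) \<partial>P n) < e"
    by (rule order_tendstoD)
  then have "\<forall>\<^sub>F n in sequentially. measure (P n) {\<omega> \<in> space (P n). real k + 1 < norm (X n \<omega>)} < e"
  proof eventually_elim
    case (elim n)
    interpret prob_space "P n" by (rule P)
    have "(\<integral>\<omega>. indicator {\<omega> \<in> space (P n). real k + 1 < norm (X n \<omega>)} \<omega> \<partial>P n) \<le> (\<integral>\<omega>. f (X n \<omega>) \<partial>P n)"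
    proof (rule integral_mono)
      show "integrable (P n) (\<lambda>\<omega>. f (X n \<omega>))"
        by (rule integrable_const_bound[of _ 1]) (use f01 in auto)
      show "integrable (P n) (indicator {\<omega> \<in> space (P n). real k + 1 < norm (X n \<omega>)} :: _ \<Rightarrow> real)"
        by (auto simp: emeasure_eq_measure)
    qed (auto simp: f_def indicator_def)
    with elim show ?case by simp
  qed
  then show ?thesis by (rule that)
qed

text \<open>The distances truncated at 1 are integrable and tend to 0 in mean, and convergence in
  mean has an almost surely convergent subsequence. Once a truncated distance is below 1 it is the
  distance itself.\<close>

lemma converges_in_prob_AE_subseq:
  fixes G :: "nat \<Rightarrow> 'a \<Rightarrow> 'e::euclidean_space"
  assumes P: "prob_space P" and G [measurable]: "\<And>n. G n \<in> borel_measurable P"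
    and conv: "converges_in_prob (\<lambda>n. P) G c"
  obtains r :: "nat \<Rightarrow> nat" where "strict_mono r" "AE \<omega> in P. (\<lambda>n. G (r n) \<omega>) \<longlonglongrightarrow> c"
proof -
  interpret prob_space P by (rule P)
  define u where "u n \<omega> = min 1 (dist (G n \<omega>) c)" for n \<omega>
  have [measurable]: "u n \<in> borel_measurable P" for n
    unfolding u_def by measurable
  have u01: "0 \<le> u n \<omega>" "u n \<omega> \<le> 1" for n \<omega>
    by (auto simp: u_def)
  have int: "integrable P (u n)" for n
    by (rule integrable_const_bound[of _ 1]) (use u01 in auto)
  have "(\<lambda>n. integral\<^sup>L P (u n)) \<longlonglongrightarrow> 0"
  proof (rule LIMSEQ_I, simp)
    fix e :: real assume e: "0 < e"
    have "(\<lambda>n. measure P {\<omega> \<in> space P. e / 2 < dist (G n \<omega>) c}) \<longlonglongrightarrow> 0"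
      using conv[unfolded converges_in_prob_def, rule_format, OF half_gt_zero[OF e]] .
    then have "\<forall>\<^sub>F n in sequentially. measure P {\<omega> \<in> space P. e / 2 < dist (G n \<omega>) c} < e / 2"
      using e by (intro order_tendstoD) auto
    then have "\<forall>\<^sub>F n in sequentially. \<bar>integral\<^sup>L P (u n)\<bar> < e"
    proof eventually_elim
      case (elim n)
      let ?A = "{\<omega> \<in> space P. e / 2 < dist (G n \<omega>) c}"
      have "integral\<^sup>L P (u n) \<le> (\<integral>\<omega>. e / 2 + indicator ?A \<omega> \<partial>P)"
      proof (rule integral_mono)
        show "integrable P (\<lambda>\<omega>. e / 2 + indicator ?A \<omega>)"
          by (intro Bochner_Integration.integrable_add) (auto simp: emeasure_eq_measure)
      qed (use int e in \<open>auto simp: u_def indicator_def\<close>)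
      also have "\<dots> = e / 2 + prob ?A"
        by (subst Bochner_Integration.integral_add) (auto simp: prob_space emeasure_eq_measure)
      also have "\<dots> < e" using elim by simp
      finally show ?case
        using u01 by (simp add: integral_nonneg_AE)
    qed
    then show "\<exists>no. \<forall>n\<ge>no. \<bar>integral\<^sup>L P (u n)\<bar> < e"
      by (simp add: eventually_sequentially)
  qed
  then have "(\<lambda>n. \<integral>\<omega>. norm (u n \<omega>) \<partial>P) \<longlonglongrightarrow> 0"
    using u01 by simp
  then obtain r :: "nat \<Rightarrow> nat" where r: "strict_mono r" "AE \<omega> in P. (\<lambda>n. u (r n) \<omega>) \<longlonglongrightarrow> 0"
    using tendsto_L1_AE_subseq[of P u] int by blast
  have conv_G: "(\<lambda>n. G (r n) \<omega>) \<longlonglongrightarrow> c" if "(\<lambda>n. u (r n) \<omega>) \<longlonglongrightarrow> 0" for \<omega>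
  proof -
    have "\<forall>\<^sub>F n in sequentially. u (r n) \<omega> < 1"
      using that by (rule order_tendstoD) simp
    then have "\<forall>\<^sub>F n in sequentially. u (r n) \<omega> = dist (G (r n) \<omega>) c"
      by eventually_elim (simp add: u_def min_def split: if_splits)
    with that have "(\<lambda>n. dist (G (r n) \<omega>) c) \<longlonglongrightarrow> 0"
      by (rule Lim_transform_eventually)
    then show ?thesis by (rule tendsto_dist_iff[THEN iffD2])
  qed
  have "AE \<omega> in P. (\<lambda>n. G (r n) \<omega>) \<longlonglongrightarrow> c"
    using r(2) by eventually_elim (rule conv_G)
  with r(1) show ?thesis by (rule that)
qed

section \<open>The limit law\<close>

lemma measure_tendsto_0_AE:
  assumes P: "prob_space P" and A [measurable]: "\<And>n. A n \<in> sets P"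
    and ev: "AE \<omega> in P. \<forall>\<^sub>F n in sequentially. \<omega> \<notin> A n"
  shows "(\<lambda>n. measure P (A n)) \<longlonglongrightarrow> 0"
proof -
  interpret prob_space P by (rule P)
  have "(\<lambda>n. \<integral>\<omega>. indicator (A n) \<omega> \<partial>P) \<longlonglongrightarrow> (\<integral>\<omega>. 0 \<partial>P :: real)"
  proof (rule integral_dominated_convergence[where w = "\<lambda>_. 1"])
    show "AE \<omega> in P. (\<lambda>n. indicator (A n) \<omega> :: real) \<longlonglongrightarrow> 0"
      using ev
    proof eventually_elim
      case (elim \<omega>)
      then show ?case
        by (intro tendsto_eventually) (auto elim!: eventually_mono)
    qed
  qed (auto simp: indicator_def)
  then show ?thesis by simp
qed

lemma converges_in_prob_AE:
  fixes Y :: "nat \<Rightarrow> 'a \<Rightarrow> real"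
  assumes P: "prob_space P" and Y [measurable]: "\<And>n. Y n \<in> borel_measurable P"
    and ev: "AE \<omega> in P. (\<lambda>n. Y n \<omega>) \<longlonglongrightarrow> c"
  shows "converges_in_prob (\<lambda>n. P) Y c"
  unfolding converges_in_prob_def
proof (intro allI impI)
  fix e :: real assume e: "0 < e"
  show "(\<lambda>n. measure P {\<omega> \<in> space P. e < dist (Y n \<omega>) c}) \<longlonglongrightarrow> 0"
  proof (rule measure_tendsto_0_AE[OF P])
    show "AE \<omega> in P. \<forall>\<^sub>F n in sequentially. \<omega> \<notin> {\<omega> \<in> space P. e < dist (Y n \<omega>) c}"
      using ev
    proof eventually_elim
      case (elim \<omega>)
      from tendstoD[OF this e] show ?case
        by eventually_elim simp
    qed
  qed measurable
qed

lemma converges_in_prob_diff: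
  fixes Y Z :: "nat \<Rightarrow> 'a \<Rightarrow> real"
  assumes P: "\<And>n. prob_space (P n)"
    and [measurable]: "\<And>n. Y n \<in> borel_measurable (P n)" "\<And>n. Z n \<in> borel_measurable (P n)"
    and Y: "converges_in_prob P Y a" and Z: "converges_in_prob P Z b"
  shows "converges_in_prob P (\<lambda>n \<omega>. Y n \<omega> - Z n \<omega>) (a - b)"
  unfolding converges_in_prob_def
proof (intro allI impI)
  fix e :: real assume e: "0 < e"
  let ?A = "\<lambda>n. {\<omega> \<in> space (P n). e / 2 < dist (Y n \<omega>) a}"
  let ?B = "\<lambda>n. {\<omega> \<in> space (P n). e / 2 < dist (Z n \<omega>) b}"
  have "(\<lambda>n. measure (P n) (?A n) + measure (P n) (?B n)) \<longlonglongrightarrow> 0 + 0"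
    by (intro tendsto_add Y[unfolded converges_in_prob_def, rule_format, OF half_gt_zero[OF e]]
        Z[unfolded converges_in_prob_def, rule_format, OF half_gt_zero[OF e]])
  then have lim: "(\<lambda>n. measure (P n) (?A n) + measure (P n) (?B n)) \<longlonglongrightarrow> 0" by simp
  show "(\<lambda>n. measure (P n) {\<omega> \<in> space (P n). e < dist (Y n \<omega> - Z n \<omega>) (a - b)}) \<longlonglongrightarrow> 0"
  proof (rule Lim_null_comparison[OF _ lim], rule always_eventually, rule allI)
    fix n
    interpret prob_space "P n" by (rule P)
    have "prob {\<omega> \<in> space (P n). e < dist (Y n \<omega> - Z n \<omega>) (a - b)} \<le> prob (?A n \<union> ?B n)"
    proof (rule finite_measure_mono)
      show "{\<omega> \<in> space (P n). e < dist (Y n \<omega> - Z n \<omega>) (a - b)} \<subseteq> ?A n \<union> ?B n"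
        unfolding dist_real_def by (safe; linarith)
    qed measurable
    also have "\<dots> \<le> prob (?A n) + prob (?B n)"
      by (rule measure_Un_le) measurable
    finally show "norm (prob {\<omega> \<in> space (P n). e < dist (Y n \<omega> - Z n \<omega>) (a - b)}) \<le> prob (?A n) + prob (?B n)"
      by simp
  qed
qed

lemma filterlim_inverse_sqrt_nat:
  assumes "filterlim N at_top sequentially"
  shows "(\<lambda>n. 1 / sqrt (real (N n))) \<longlonglongrightarrow> 0"
proof -
  have "filterlim (\<lambda>n. sqrt (real (N n))) at_top sequentially"
    by (intro filterlim_compose[OF sqrt_at_top] filterlim_compose[OF filterlim_real_sequentially assms])
  then show ?thesis
    using tendsto_inverse_0_at_top by (simp add: inverse_eq_divide)
qed

text \<open>The uniform estimate with \<open>t = 1 / sqrt (N n)\<close> applies off two unlikely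
  events: a large \<open>X n\<close>, excluded by tightness, and a weight matrix far from
  \<open>\<Gamma>\<close>. The base points are deterministic: the constant \<open>M0\<close> for the
  sample statistic, and \<open>Mc n \<omega>\<close> at a fixed \<open>\<omega>\<close> for the
  bootstrap.\<close>

lemma scaled_min_rank_sq_in_prob:
  fixes M :: "real^'h^'p" and \<Gamma> :: "real^('h \<times> 'p)^('h \<times> 'p)"
  assumes cov: "covariance_matrix \<Gamma>" and det: "det \<Gamma> \<noteq> 0"
    and P: "\<And>n. prob_space (P n)"
    and [measurable]: "\<And>n. X n \<in> borel_measurable (P n)" "\<And>n. G n \<in> borel_measurable (P n)"
    and Q: "prob_space Q" and W: "W \<in> borel_measurable Q"
    and law: "converges_in_law P X Q W" and G: "converges_in_prob P G \<Gamma>"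
    and A: "A \<longlonglongrightarrow> M" and rank: "\<forall>\<^sub>F n in sequentially. rank (A n) = rank M"
    and N: "filterlim N at_top sequentially"
  shows "converges_in_prob P (\<lambda>n \<omega>. real (N n) *
      min_rank_sq (rank M) (G n \<omega>) (A n + (1 / sqrt (real (N n))) *\<^sub>R X n \<omega>) - tangent_sq \<Gamma> M (X n \<omega>)) 0"
  unfolding converges_in_prob_def
proof (intro allI impI)
  fix e :: real assume e: "0 < e"
  define Y where "Y n \<omega> = real (N n) *
      min_rank_sq (rank M) (G n \<omega>) (A n + (1 / sqrt (real (N n))) *\<^sub>R X n \<omega>) - tangent_sq \<Gamma> M (X n \<omega>)" for n \<omega>
  show "(\<lambda>n. measure (P n) {\<omega> \<in> space (P n). e < dist (Y n \<omega>) 0}) \<longlonglongrightarrow> 0"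
  proof (rule order_tendstoI)
    fix \<eta> :: real assume \<eta>: "0 < \<eta>"
    obtain R where R: "\<forall>\<^sub>F n in sequentially. measure (P n) {\<omega> \<in> space (P n). R < norm (X n \<omega>)} < \<eta> / 2"
      by (rule converges_in_law_tight[OF P _ Q W law half_gt_zero[OF \<eta>]]) measurable
    obtain d where d: "0 < d" and unif: "\<And>t A G Z. 0 < t \<Longrightarrow> t < d \<Longrightarrow> rank A = rank M \<Longrightarrow>
        norm (A - M) < d \<Longrightarrow> norm (G - \<Gamma>) < d \<Longrightarrow> norm Z \<le> R \<Longrightarrow>
        \<bar>min_rank_sq (rank M) G (A + t *\<^sub>R Z) / t\<^sup>2 - tangent_sq \<Gamma> M Z\<bar> < e"
      using min_rank_sq_uniform[OF cov det e, of M R] by blast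
    have 1: "\<forall>\<^sub>F n in sequentially. measure (P n) {\<omega> \<in> space (P n). d / 2 < dist (G n \<omega>) \<Gamma>} < \<eta> / 2"
      using G[unfolded converges_in_prob_def, rule_format, OF half_gt_zero[OF d]] \<eta>
      by (intro order_tendstoD) auto
    have 2: "\<forall>\<^sub>F n in sequentially. 1 / sqrt (real (N n)) < d"
      using filterlim_inverse_sqrt_nat[OF N] d by (rule order_tendstoD)
    have 3: "\<forall>\<^sub>F n in sequentially. dist (A n) M < d"
      using A d by (rule tendstoD)
    have 4: "\<forall>\<^sub>F n in sequentially. 0 < N n"
      using filterlim_at_top[THEN iffD1, OF N, rule_format, of 1] by eventually_elim simp
    show "\<forall>\<^sub>F n in sequentially. measure (P n) {\<omega> \<in> space (P n). e < dist (Y n \<omega>) 0} < \<eta>"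
      using R 1 2 3 4 rank
    proof eventually_elim
      case (elim n)
      interpret prob_space "P n" by (rule P)
      have small: "\<bar>Y n \<omega>\<bar> < e" if "norm (X n \<omega>) \<le> R" "dist (G n \<omega>) \<Gamma> \<le> d / 2" for \<omega>
        using unif[of "1 / sqrt (real (N n))" "A n" "G n \<omega>" "X n \<omega>"] elim that d
        by (simp add: Y_def dist_norm power_divide mult.commute)
      have "prob {\<omega> \<in> space (P n). e < dist (Y n \<omega>) 0} \<le>
          prob ({\<omega> \<in> space (P n). R < norm (X n \<omega>)} \<union> {\<omega> \<in> space (P n). d / 2 < dist (G n \<omega>) \<Gamma>})"
      proof (rule finite_measure_mono)
        show "{\<omega> \<in> space (P n). e < dist (Y n \<omega>) 0} \<subseteq>
            {\<omega> \<in> space (P n). R < norm (X n \<omega>)} \<union> {\<omega> \<in> space (P n). d / 2 < dist (G n \<omega>) \<Gamma>}"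
          using small by (force simp: not_le[symmetric])
      qed measurable
      also have "\<dots> \<le> prob {\<omega> \<in> space (P n). R < norm (X n \<omega>)} + prob {\<omega> \<in> space (P n). d / 2 < dist (G n \<omega>) \<Gamma>}"
        by (rule measure_Un_le) measurable
      also have "\<dots> < \<eta>" using elim by linarith
      finally show ?case .
    qed
  qed (auto intro!: always_eventually intro: less_le_trans)
qed

text \<open>A nonzero determinant still leaves its sign open. If it were negative, the square root
  in the denominator would be negative as well, \<open>ennreal\<close> would cut the density to 0,
  and the total mass could not be 1.\<close>

lemma (in prob_space) mvn_density_pos:
  fixes \<Sigma> :: "real^'k^'k"
  assumes X: "distributed M lborel X (\<lambda>v. ennreal (mvn_density \<mu> \<Sigma> v))" and det: "det \<Sigma> \<noteq> 0"
  shows "0 < mvn_density \<mu> \<Sigma> v"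
proof -
  have "0 < det \<Sigma>"
  proof (rule ccontr)
    assume "\<not> ?thesis"
    with det have "(2 * pi) ^ CARD('k) * det \<Sigma> < 0"
      by (simp add: mult_less_0_iff)
    then have "mvn_density \<mu> \<Sigma> v \<le> 0" for v
      unfolding mvn_density_def by (intro divide_nonneg_nonpos) auto
    then have "emeasure M (X -` UNIV \<inter> space M) = 0"
      by (subst distributed_emeasure[OF X]) (auto simp: ennreal_neg)
    then show False
      by (simp add: emeasure_space_1)
  qed
  then show ?thesis
    unfolding mvn_density_def by (intro divide_pos_pos) auto
qed

lemma open_not_null_sets_lborel:
  fixes U :: "'a::euclidean_space set"
  assumes "open U" "U \<noteq> {}"
  shows "U \<notin> null_sets lborel"
  using open_not_negligible[OF assms] null_sets_completionI[of U lborel]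
  by (auto simp: negligible_iff_null_sets)

section \<open>Distribution of the limit functional of the normal matrix\<close>

context
  fixes \<Gamma> :: "real^('h::finite \<times> 'p::finite)^('h \<times> 'p)" and M :: "real^'h^'p"
    and Q :: "'c measure" and W :: "'c \<Rightarrow> real^'h^'p"
  assumes cov: "covariance_matrix \<Gamma>" and det: "det \<Gamma> \<noteq> 0"
    and rank: "rank M < CARD('p)" "rank M < CARD('h)"
    and Q: "prob_space Q" and W [measurable]: "W \<in> borel_measurable Q"
    and normal: "distributed Q lborel (\<lambda>x. vectorize (W x)) (\<lambda>v. ennreal (mvn_density 0 \<Gamma> v))"
begin

interpretation Q: prob_space Q by (rule Q)

lemma measurable_tangent_sq [measurable]: "tangent_sq \<Gamma> M \<in> borel_measurable borel"
  using weighted_sq_nonneg[OF cov det] by (intro borel_measurable_continuous_onI continuous_on_tangent_sq)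

lemma tangent_sq_law_real_distribution: "real_distribution (distr Q borel (\<lambda>x. tangent_sq \<Gamma> M (W x)))"
  by (intro Q.real_distribution_distr) measurable

interpretation D: real_distribution "distr Q borel (\<lambda>x. tangent_sq \<Gamma> M (W x))"
  by (rule tangent_sq_law_real_distribution)

text \<open>This moves questions about the limit law to Lebesgue measure on the vectorized space,
  where null sets and open sets are easy to recognize.\<close>

lemma tangent_sq_law_measure:
  assumes [measurable]: "S \<in> sets borel"
  shows "emeasure (distr Q borel (\<lambda>x. tangent_sq \<Gamma> M (W x))) S =
    (\<integral>\<^sup>+v. ennreal (mvn_density 0 \<Gamma> v) * indicator ((\<lambda>v. tangent_sq \<Gamma> M (unvectorize v)) -` S) v \<partial>lborel)"
proof -
  have [measurable]: "unvectorize \<in> borel_measurable borel"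
    by (intro borel_measurable_continuous_onI linear_continuous_on linear_conv_bounded_linear[THEN iffD1] linear_unvectorize)
  have "(\<lambda>v. tangent_sq \<Gamma> M (unvectorize v)) \<in> borel_measurable borel"
    by measurable
  from measurable_sets[OF this, of S] have "(\<lambda>v. tangent_sq \<Gamma> M (unvectorize v)) -` S \<in> sets borel"
    by simp
  then have "(\<integral>\<^sup>+v. ennreal (mvn_density 0 \<Gamma> v) * indicator ((\<lambda>v. tangent_sq \<Gamma> M (unvectorize v)) -` S) v \<partial>lborel) =
      emeasure Q ((\<lambda>x. vectorize (W x)) -` ((\<lambda>v. tangent_sq \<Gamma> M (unvectorize v)) -` S) \<inter> space Q)"
    by (subst distributed_emeasure[OF normal]) auto
  also have "\<dots> = emeasure (distr Q borel (\<lambda>x. tangent_sq \<Gamma> M (W x))) S"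
    by (subst emeasure_distr) (auto intro!: arg_cong[where f = "emeasure Q"])
  finally show ?thesis by simp
qed

lemma tangent_sq_posE: obtains Z where "0 < tangent_sq \<Gamma> M Z"
proof -
  obtain c C where c: "0 < c" "0 < C" and
    ev: "\<forall>\<^sub>F G in nhds \<Gamma>. \<forall>A. c * (norm A)\<^sup>2 \<le> weighted_sq G A \<and> weighted_sq G A \<le> C * (norm A)\<^sup>2"
    by (rule weighted_sq_bounds[OF cov det])
  show ?thesis
    by (rule tangent_sq_pos[OF weighted_sq_nonneg[OF cov det] c(1) _ rank_tangent_ne_UNIV[OF rank]])
      (use eventually_nhds_x_imp_x[OF ev] that in auto)
qed

text \<open>Level sets of the convex 2-homogeneous function \<^term>\<open>tangent_sq \<Gamma> M\<close> lie in the boundary of its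
  convex sublevel sets, hence are Lebesgue null.\<close>

lemma tangent_sq_law_no_atoms: "measure (distr Q borel (\<lambda>x. tangent_sq \<Gamma> M (W x))) {c} = 0"
proof -
  note nonneg = weighted_sq_nonneg[OF cov det]
  define \<psi> where "\<psi> v = tangent_sq \<Gamma> M (unvectorize v)" for v
  have convex: "convex_on UNIV \<psi>"
    using convex_on_tangent_sq[OF nonneg, of M] unfolding convex_on_def \<psi>_def
    by (simp add: linear_add[OF linear_unvectorize] linear_scale[OF linear_unvectorize])
  have scale: "\<psi> (s *\<^sub>R v) = s\<^sup>2 * \<psi> v" for s v
    by (simp add: \<psi>_def linear_scale[OF linear_unvectorize] tangent_sq_scaleR[OF nonneg])
  have \<psi>0: "0 \<le> \<psi> v" for v
    by (simp add: \<psi>_def tangent_sq_nonneg[OF nonneg])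
  obtain z where z: "0 < \<psi> z"
    using tangent_sq_posE \<psi>_def unvectorize_vectorize by metis
  let ?C = "{v. \<psi> v \<le> c}"
  have "convex ?C"
  proof (rule convexI)
    fix x y and u v :: real
    assume xy: "x \<in> ?C" "y \<in> ?C" and uv: "0 \<le> u" "0 \<le> v" "u + v = 1"
    then have "\<psi> (u *\<^sub>R x + v *\<^sub>R y) \<le> u * \<psi> x + v * \<psi> y"
      using convex unfolding convex_on_def by blast
    also have "\<dots> \<le> c"
      using xy uv by (intro convex_bound_le) auto
    finally show "u *\<^sub>R x + v *\<^sub>R y \<in> ?C" by simp
  qed
  then have "negligible (frontier ?C)"
    by (rule negligible_convex_frontier)
  then have null: "frontier ?C \<in> null_sets lborel"
    by (auto simp: negligible_iff_null_sets null_sets_completion_iff)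
  have "\<psi> -` {c} \<subseteq> frontier ?C"
  proof
    fix v assume "v \<in> \<psi> -` {c}"
    then have v: "\<psi> v = c" by simp
    have "v \<notin> interior ?C"
    proof
      assume "v \<in> interior ?C"
      then obtain e where e: "0 < e" "ball v e \<subseteq> ?C"
        by (auto simp: mem_interior)
      have near: "\<psi> (v + s *\<^sub>R u) \<le> c" if "\<bar>s\<bar> * norm u < e" for s u
      proof -
        have "v + s *\<^sub>R u \<in> ball v e"
          using that by (simp add: dist_norm)
        with e(2) show ?thesis by blast
      qed
      \<comment> \<open>At level 0 the midpoint of \<open>v + s *\<^sub>R z\<close> and
        \<open>- v\<close> is a multiple of \<open>z\<close>, so convexity would force the positive
        value there to be at most 0. At a positive level, moving outward from \<open>v\<close> along
        its own ray already raises the value.\<close>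
      show False
      proof (cases "c = 0")
        case True
        define s where "s = e / 2 / (norm z + 1)"
        have s: "0 < s" using e(1) by (simp add: s_def add_nonneg_pos)
        have "norm z + 1 \<noteq> 0" using norm_ge_zero[of z] by linarith
        then have "s * (norm z + 1) = e / 2" by (rule nonzero_eq_divide_eq[THEN iffD1, OF _ s_def])
        then have "s * norm z < e"
          using s e(1) by (simp add: distrib_left)
        then have "\<psi> (v + s *\<^sub>R z) \<le> 0"
          using near[of s z] s True by simp
        moreover have "\<psi> (- v) = 0"
          using scale[of "-1" v] v True by simp
        moreover have "\<psi> ((1 - 1 / 2) *\<^sub>R (v + s *\<^sub>R z) + (1 / 2) *\<^sub>R (- v)) \<le> (1 - 1 / 2) * \<psi> (v + s *\<^sub>R z) + 1 / 2 * \<psi> (- v)"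
          by (rule convex_onD[OF convex]) auto
        moreover have "(1 - 1 / 2) *\<^sub>R (v + s *\<^sub>R z) + (1 / 2) *\<^sub>R (- v) = (s / 2) *\<^sub>R z"
          by (simp add: scaleR_add_right)
        ultimately have "\<psi> ((s / 2) *\<^sub>R z) \<le> 0" by simp
        moreover have "0 < \<psi> ((s / 2) *\<^sub>R z)"
          using s z by (simp add: scale)
        ultimately show False by simp
      next
        case False
        then have c: "0 < c" using v \<psi>0[of v] by simp
        define s where "s = e / 2 / (norm v + 1)"
        have s: "0 < s" using e(1) by (simp add: s_def add_nonneg_pos)
        have "norm v + 1 \<noteq> 0" using norm_ge_zero[of v] by linarith
        then have "s * (norm v + 1) = e / 2" by (rule nonzero_eq_divide_eq[THEN iffD1, OF _ s_def])
        then have "s * norm v < e"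
          using s e(1) by (simp add: distrib_left)
        then have "\<psi> ((1 + s) *\<^sub>R v) \<le> c"
          using near[of s v] s by (simp add: scaleR_add_left)
        then have "(1 + s)\<^sup>2 * c \<le> c"
          by (simp add: scale v)
        moreover have "1 < (1 + s)\<^sup>2"
          using s by (simp add: power2_eq_square algebra_simps add_pos_nonneg)
        ultimately show False using c by simp
      qed
    qed
    moreover have "v \<in> closure ?C"
      using v closure_subset by fastforce
    ultimately show "v \<in> frontier ?C"
      by (simp add: frontier_def)
  qed
  moreover have "\<psi> -` {c} \<in> sets borel"
  proof -
    have "continuous_on UNIV \<psi>"
      using convex by (intro convex_on_continuous) auto
    then have "closed (\<psi> -` {c})"
      using continuous_closed_vimage[of "{c}" \<psi>] by (auto simp: continuous_on_eq_continuous_at)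
    then show ?thesis by simp
  qed
  ultimately have "\<psi> -` {c} \<in> null_sets lborel"
    using null_sets_subset[OF null] by simp
  then have "emeasure (distr Q borel (\<lambda>x. tangent_sq \<Gamma> M (W x))) {c} = 0"
    by (subst tangent_sq_law_measure) (auto simp: \<psi>_def[abs_def] intro: nn_integral_null_set)
  then show ?thesis by (simp add: measure_def)
qed

lemma isCont_cdf_tangent_sq_law: "isCont (cdf (distr Q borel (\<lambda>x. tangent_sq \<Gamma> M (W x)))) c"
  using tangent_sq_law_no_atoms D.isCont_cdf by blast

lemma cdf_tangent_sq_law_0: "cdf (distr Q borel (\<lambda>x. tangent_sq \<Gamma> M (W x))) 0 = 0"
proof -
  have "cdf (distr Q borel (\<lambda>x. tangent_sq \<Gamma> M (W x))) 0 = measure (distr Q borel (\<lambda>x. tangent_sq \<Gamma> M (W x))) {0}"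
    unfolding cdf_def2 using tangent_sq_nonneg[OF weighted_sq_nonneg[OF cov det], of M]
    by (subst (1 2) measure_distr) (auto intro!: arg_cong[where f = "measure Q"] antisym)
  then show ?thesis by (simp add: tangent_sq_law_no_atoms)
qed

text \<open>By homogeneity a suitable multiple of \<open>Z\<close> attains the midpoint of
  \<open>a\<close> and \<open>b\<close>, so the preimage of the open interval is open and nonempty.
  It has positive Lebesgue measure, and the normal density is positive everywhere.\<close>

lemma cdf_tangent_sq_law_strict_mono:
  assumes ab: "0 \<le> a" "a < b"
  shows "cdf (distr Q borel (\<lambda>x. tangent_sq \<Gamma> M (W x))) a < cdf (distr Q borel (\<lambda>x. tangent_sq \<Gamma> M (W x))) b"
proof -
  let ?D = "distr Q borel (\<lambda>x. tangent_sq \<Gamma> M (W x))"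
  let ?U = "(\<lambda>v. tangent_sq \<Gamma> M (unvectorize v)) -` {a<..<b}"
  note nonneg = weighted_sq_nonneg[OF cov det]
  obtain Z where Z: "0 < tangent_sq \<Gamma> M Z" by (rule tangent_sq_posE)
  define s where "s = sqrt ((a + b) / 2 / tangent_sq \<Gamma> M Z)"
  have "tangent_sq \<Gamma> M (s *\<^sub>R Z) = (a + b) / 2"
    using Z ab by (simp add: tangent_sq_scaleR[OF nonneg] s_def)
  then have "vectorize (s *\<^sub>R Z) \<in> ?U"
    using ab by simp
  moreover have "open ?U"
    by (intro open_vimage continuous_on_compose2[OF continuous_on_tangent_sq[OF nonneg]] linear_continuous_on
        linear_conv_bounded_linear[THEN iffD1] linear_unvectorize) auto
  ultimately have U: "?U \<notin> null_sets lborel" "?U \<in> sets lborel"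
    using open_not_null_sets_lborel[of ?U] by (blast, simp)
  have "emeasure ?D {a<..<b} \<noteq> 0"
  proof
    assume "emeasure ?D {a<..<b} = 0"
    then have "(\<integral>\<^sup>+v. ennreal (mvn_density 0 \<Gamma> v) * indicator ?U v \<partial>lborel) = 0"
      by (subst (asm) tangent_sq_law_measure) auto
    moreover have "(\<lambda>v. ennreal (mvn_density 0 \<Gamma> v)) \<in> borel_measurable lborel"
      using normal by (auto simp: distributed_def)
    ultimately have "AE v in lborel. ennreal (mvn_density 0 \<Gamma> v) * indicator ?U v = 0"
      using U(2) by (subst (asm) nn_integral_0_iff_AE) auto
    then have "AE v in lborel. v \<notin> ?U"
      by eventually_elim
        (use Q.mvn_density_pos[OF normal det] in \<open>auto simp: indicator_def ennreal_eq_0_iff not_less[THEN sym]\<close>)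
    with U show False
      using AE_iff_null_sets[of ?U lborel] by blast
  qed
  then have "0 < measure ?D {a<..<b}"
    by (simp add: D.emeasure_eq_measure zero_less_measure_iff)
  also have "\<dots> \<le> measure ?D {a<..b}"
    by (rule D.finite_measure_mono) auto
  also have "\<dots> = cdf ?D b - cdf ?D a"
    using D.cdf_diff_eq[OF ab(2)] by simp
  finally show ?thesis by simp
qed

lemma tangent_sq_law_quantileE:
  assumes "0 < \<alpha>" "\<alpha> < 1"
  obtains q where "0 < q" "cdf (distr Q borel (\<lambda>x. tangent_sq \<Gamma> M (W x))) q = \<alpha>"
proof -
  let ?F = "cdf (distr Q borel (\<lambda>x. tangent_sq \<Gamma> M (W x)))"
  obtain b where b: "\<alpha> < ?F b"
    using eventually_happens'[OF trivial_limit_at_top_linorder order_tendstoD(1)[OF D.cdf_lim_at_top_prob assms(2)]]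
    by blast
  have "0 \<le> b"
    using D.cdf_nondecreasing[of b 0] b assms(1) cdf_tangent_sq_law_0 by (cases "0 \<le> b") auto
  then obtain q where q: "0 \<le> q" "q \<le> b" "?F q = \<alpha>"
    using IVT'[of ?F 0 \<alpha> b] b assms(1) isCont_cdf_tangent_sq_law cdf_tangent_sq_law_0
    by (auto intro: continuous_at_imp_continuous_on less_imp_le)
  moreover have "q \<noteq> 0"
    using q assms(1) cdf_tangent_sq_law_0 by auto
  ultimately show ?thesis
    using that[of q] by simp
qed

end

lemma quantile_tendsto:
  assumes \<nu>: "\<And>n. real_distribution (\<nu> n)" and lim: "\<And>x. (\<lambda>n. cdf (\<nu> n) x) \<longlonglongrightarrow> F x"
    and mono: "\<And>a b. 0 \<le> a \<Longrightarrow> a < b \<Longrightarrow> F a < F b"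
    and q: "0 < q" "F q = \<alpha>" and \<alpha>: "0 < \<alpha>" "\<alpha> < 1"
  shows "(\<lambda>n. quantile (\<nu> n) \<alpha>) \<longlonglongrightarrow> q"
proof (rule order_tendstoI)
  fix a assume a: "a < q"
  \<comment> \<open>Strict growth of \<open>F\<close> is known only on the half line, so the
    comparison point is clipped at 0, which still lies below \<open>q\<close>.\<close>
  have "F (max a 0) < \<alpha>"
    using mono[of "max a 0" q] a q by simp
  with lim have "\<forall>\<^sub>F n in sequentially. cdf (\<nu> n) (max a 0) < \<alpha>"
    by (rule order_tendstoD)
  then show "\<forall>\<^sub>F n in sequentially. a < quantile (\<nu> n) \<alpha>"
  proof eventually_elim
    case (elim n)
    then have "\<not> quantile (\<nu> n) \<alpha> \<le> max a 0"
      using real_distribution.quantile_le_iff[OF \<nu> \<alpha>] by (simp add: not_le)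
    then show ?case by simp
  qed
next
  fix a assume a: "q < a"
  have "\<alpha> < F ((q + a) / 2)"
    using mono[of q "(q + a) / 2"] a q by simp
  with lim have "\<forall>\<^sub>F n in sequentially. \<alpha> < cdf (\<nu> n) ((q + a) / 2)"
    by (rule order_tendstoD)
  then show "\<forall>\<^sub>F n in sequentially. quantile (\<nu> n) \<alpha> < a"
  proof eventually_elim
    case (elim n)
    then have "quantile (\<nu> n) \<alpha> \<le> (q + a) / 2"
      using real_distribution.quantile_le_iff[OF \<nu> \<alpha>] less_imp_le by blast
    with a show ?case by simp
  qed
qed

section \<open>Consistency of the bootstrap test\<close>

text \<open>The setting of the theorem along a sequence \<open>N\<close> of sample sizes, with \<open>\<Gamma>hat\<close> converging
  almost surely: the general case follows by passing to subsequences.\<close>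

locale rank_bootstrap =
  fixes M0 :: "real^'h::finite^'p::finite"
    and m :: nat
    and \<Gamma> :: "real^('h \<times> 'p)^('h \<times> 'p)"
    and P :: "'w measure"
    and Mhat Mc :: "nat \<Rightarrow> 'w \<Rightarrow> real^'h^'p"
    and \<Gamma>hat :: "nat \<Rightarrow> 'w \<Rightarrow> real^('h \<times> 'p)^('h \<times> 'p)"
    and Q :: "'c measure"
    and W :: "'c \<Rightarrow> real^'h^'p"
    and B :: "nat \<Rightarrow> 'b measure"
    and K :: "nat \<Rightarrow> 'w \<Rightarrow> 'b measure"
    and Wstar :: "nat \<Rightarrow> 'w \<Rightarrow> 'b \<Rightarrow> real^'h^'p"
    and \<Gamma>star :: "nat \<Rightarrow> 'w \<Rightarrow> 'b \<Rightarrow> real^('h \<times> 'p)^('h \<times> 'p)"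
    and N :: "nat \<Rightarrow> nat"
  assumes pH: "CARD('p) \<le> CARD('h)"
    and P: "prob_space P"
    and Mhat_meas [measurable]: "\<And>n. Mhat n \<in> borel_measurable P"
    and \<Gamma>hat_meas [measurable]: "\<And>n. \<Gamma>hat n \<in> borel_measurable P"
    and Mc_meas [measurable]: "\<And>n. Mc n \<in> borel_measurable P"
    and K: "\<And>n. K n \<in> measurable P (prob_algebra (B n))"
    and Wstar_meas: "\<And>n. (\<lambda>(\<omega>, b). Wstar n \<omega> b) \<in> borel_measurable (P \<Otimes>\<^sub>M B n)"
    and \<Gamma>star_meas: "\<And>n. (\<lambda>(\<omega>, b). \<Gamma>star n \<omega> b) \<in> borel_measurable (P \<Otimes>\<^sub>M B n)"
    and \<Gamma>_cov: "covariance_matrix \<Gamma>"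
    and \<Gamma>_det: "det \<Gamma> \<noteq> 0"
    and Q: "prob_space Q"
    and W_meas [measurable]: "W \<in> borel_measurable Q"
    and W_normal: "distributed Q lborel (\<lambda>x. vectorize (W x)) (\<lambda>v. ennreal (mvn_density 0 \<Gamma> v))"
    and Mhat_law: "converges_in_law (\<lambda>n. P) (\<lambda>n \<omega>. sqrt (real (N n)) *\<^sub>R (Mhat n \<omega> - M0)) Q W"
    and Mhat_as: "AE \<omega> in P. (\<lambda>n. Mhat n \<omega>) \<longlonglongrightarrow> M0"
    and \<Gamma>hat_as: "AE \<omega> in P. (\<lambda>n. \<Gamma>hat n \<omega>) \<longlonglongrightarrow> \<Gamma>"
    and \<Gamma>hat_prob: "converges_in_prob (\<lambda>n. P) \<Gamma>hat \<Gamma>"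
    and \<Gamma>star_prob: "AE \<omega> in P. converges_in_prob (\<lambda>n. K n \<omega>) (\<lambda>n. \<Gamma>star n \<omega>) \<Gamma>"
    and Mc_argmin: "\<And>n \<omega>. \<omega> \<in> space P \<Longrightarrow> \<exists>A. is_rank_argmin m (\<Gamma>hat n \<omega>) (Mhat n \<omega>) A
                       \<Longrightarrow> is_rank_argmin m (\<Gamma>hat n \<omega>) (Mhat n \<omega>) (Mc n \<omega>)"
    and Wstar_law: "AE \<omega> in P. converges_in_law (\<lambda>n. K n \<omega>) (\<lambda>n. Wstar n \<omega>) Q W"
    and N: "filterlim N at_top sequentially"
begin

definition \<Lambda>hat :: "nat \<Rightarrow> 'w \<Rightarrow> real" where
  "\<Lambda>hat n \<omega> = real (N n) * min_rank_sq m (\<Gamma>hat n \<omega>) (Mhat n \<omega>)"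

definition \<Lambda>star :: "nat \<Rightarrow> 'w \<Rightarrow> 'b \<Rightarrow> real" where
  "\<Lambda>star n \<omega> b = real (N n) * min_rank_sq m (\<Gamma>star n \<omega> b) (Mc n \<omega> + (1 / sqrt (real (N n))) *\<^sub>R Wstar n \<omega> b)"

definition qhat :: "real \<Rightarrow> nat \<Rightarrow> 'w \<Rightarrow> real" where
  "qhat \<alpha> n \<omega> = quantile (distr (K n \<omega>) borel (\<Lambda>star n \<omega>)) \<alpha>"

lemma \<Lambda>hat_measurable [measurable]: "\<Lambda>hat n \<in> borel_measurable P"
  unfolding \<Lambda>hat_def[abs_def] by measurable

lemma \<Lambda>star_measurable: "(\<lambda>(\<omega>, b). \<Lambda>star n \<omega> b) \<in> borel_measurable (P \<Otimes>\<^sub>M B n)"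
proof -
  note [measurable] = Wstar_meas[of n] \<Gamma>star_meas[of n]
  show ?thesis
    unfolding \<Lambda>star_def[abs_def] case_prod_unfold
    by (intro borel_measurable_times borel_measurable_const borel_measurable_min_rank_sq) measurable
qed

lemma qhat_measurable: "0 < \<alpha> \<Longrightarrow> \<alpha> < 1 \<Longrightarrow> qhat \<alpha> n \<in> borel_measurable P"
  unfolding qhat_def[abs_def] using borel_measurable_quantile_kernel[OF K \<Lambda>star_measurable] .

lemma bootstrap_section:
  assumes \<omega>: "\<omega> \<in> space P"
  shows "prob_space (K n \<omega>)" "Wstar n \<omega> \<in> borel_measurable (K n \<omega>)"
    "\<Gamma>star n \<omega> \<in> borel_measurable (K n \<omega>)" "\<Lambda>star n \<omega> \<in> borel_measurable (K n \<omega>)"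
proof -
  have "K n \<omega> \<in> space (prob_algebra (B n))"
    using measurable_space[OF K \<omega>] .
  then have sets: "sets (K n \<omega>) = sets (B n)" and prob: "prob_space (K n \<omega>)"
    by (simp_all add: space_prob_algebra)
  show "prob_space (K n \<omega>)" by (rule prob)
  show "Wstar n \<omega> \<in> borel_measurable (K n \<omega>)" "\<Gamma>star n \<omega> \<in> borel_measurable (K n \<omega>)"
    "\<Lambda>star n \<omega> \<in> borel_measurable (K n \<omega>)"
    using measurable_compose[OF measurable_Pair1'[OF \<omega>] Wstar_meas]
      measurable_compose[OF measurable_Pair1'[OF \<omega>] \<Gamma>star_meas]
      measurable_compose[OF measurable_Pair1'[OF \<omega>] \<Lambda>star_measurable]
    by (simp_all add: measurable_cong_sets[OF sets refl])
qed

text \<open>The assumption on \<open>Mc\<close> speaks only of sample points at which a minimizer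
  exists. Almost surely this holds eventually: lower semicontinuity gives \<open>Mhat\<close> rank
  at least \<open>m\<close>, and \<open>\<Gamma>hat\<close> enters the neighbourhood of
  coercivity.\<close>

lemma argmin_eventually:
  assumes "m \<le> rank M0"
  shows "AE \<omega> in P. \<forall>\<^sub>F n in sequentially. is_rank_argmin m (\<Gamma>hat n \<omega>) (Mhat n \<omega>) (Mc n \<omega>)"
proof -
  obtain c C where c: "0 < c" "0 < C" and
    ev: "\<forall>\<^sub>F G in nhds \<Gamma>. \<forall>A. c * (norm A)\<^sup>2 \<le> weighted_sq G A \<and> weighted_sq G A \<le> C * (norm A)\<^sup>2"
    by (rule weighted_sq_bounds[OF \<Gamma>_cov \<Gamma>_det])
  show ?thesis
    using Mhat_as \<Gamma>hat_as AE_space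
  proof eventually_elim
    case (elim \<omega>)
    have "\<forall>\<^sub>F n in sequentially. rank M0 \<le> rank (Mhat n \<omega>)"
      using eventually_compose_filterlim[OF rank_lower_semicontinuous elim(1)] .
    then show ?case
      using eventually_compose_filterlim[OF ev elim(2)]
    proof eventually_elim
      case (elim n)
      then show ?case
        using assms c(1) by (intro Mc_argmin \<open>\<omega> \<in> space P\<close> rank_argmin_exists[of _ _ c]) auto
    qed
  qed
qed

text \<open>Under the null hypothesis \<open>M0\<close> is itself admissible, so \<open>Mc\<close>
  is no worse than \<open>M0\<close>. Comparing the weighted norm with the Euclidean one costs the
  factor \<open>sqrt (C / c)\<close>.\<close>

lemma Mc_tendsto:
  assumes rank: "rank M0 = m"
  shows "AE \<omega> in P. (\<lambda>n. Mc n \<omega>) \<longlonglongrightarrow> M0"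
proof -
  obtain c C where c: "0 < c" "0 < C" and
    ev: "\<forall>\<^sub>F G in nhds \<Gamma>. \<forall>A. c * (norm A)\<^sup>2 \<le> weighted_sq G A \<and> weighted_sq G A \<le> C * (norm A)\<^sup>2"
    by (rule weighted_sq_bounds[OF \<Gamma>_cov \<Gamma>_det])
  have "AE \<omega> in P. \<forall>\<^sub>F n in sequentially. is_rank_argmin m (\<Gamma>hat n \<omega>) (Mhat n \<omega>) (Mc n \<omega>)"
    using rank by (intro argmin_eventually) simp
  with Mhat_as \<Gamma>hat_as show ?thesis
  proof eventually_elim
    case (elim \<omega>)
    have "\<forall>\<^sub>F n in sequentially. norm (Mhat n \<omega> - Mc n \<omega>) \<le> sqrt (C / c) * norm (Mhat n \<omega> - M0)"
      using elim(3) eventually_compose_filterlim[OF ev elim(2)]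
    proof eventually_elim
      case (elim n)
      have "weighted_sq (\<Gamma>hat n \<omega>) (Mhat n \<omega> - Mc n \<omega>) \<le> weighted_sq (\<Gamma>hat n \<omega>) (Mhat n \<omega> - M0)"
        using elim(1) rank by (auto simp: is_rank_argmin_def is_arg_min_def not_less)
      then have "c * (norm (Mhat n \<omega> - Mc n \<omega>))\<^sup>2 \<le> C * (norm (Mhat n \<omega> - M0))\<^sup>2"
        using elim(2) by (meson order_trans)
      then have "(norm (Mhat n \<omega> - Mc n \<omega>))\<^sup>2 \<le> (sqrt (C / c) * norm (Mhat n \<omega> - M0))\<^sup>2"
        using c by (simp add: power_mult_distrib field_simps)
      then show ?case
        by (rule power2_le_imp_le) (use c in simp)
    qed
    moreover have "(\<lambda>n. sqrt (C / c) * norm (Mhat n \<omega> - M0)) \<longlonglongrightarrow> 0"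
      using elim(1) by (intro tendsto_mult_right_zero tendsto_norm_zero) (simp add: LIM_zero)
    ultimately have "(\<lambda>n. Mhat n \<omega> - Mc n \<omega>) \<longlonglongrightarrow> 0"
      by (rule Lim_null_comparison)
    from tendsto_diff[OF elim(1) this] show ?case by simp
  qed
qed

text \<open>At a fixed sample point outside a null set the claim concerns only the measures
  \<open>K n \<omega>\<close>, with \<open>Mc n \<omega>\<close> as deterministic base points that
  tend to \<open>M0\<close> and eventually have its rank.\<close>

lemma qhat_tendsto:
  assumes rank: "rank M0 = m" "m < CARD('p)" and \<alpha>: "0 < \<alpha>" "\<alpha> < 1"
    and q: "0 < q" "cdf (distr Q borel (\<lambda>x. tangent_sq \<Gamma> M0 (W x))) q = \<alpha>"
  shows "AE \<omega> in P. (\<lambda>n. qhat \<alpha> n \<omega>) \<longlonglongrightarrow> q"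
proof -
  have ranks: "rank M0 < CARD('p)" "rank M0 < CARD('h)"
    using rank pH by simp_all
  note law = \<Gamma>_cov \<Gamma>_det ranks Q W_meas W_normal
  have "AE \<omega> in P. \<forall>\<^sub>F n in sequentially. is_rank_argmin m (\<Gamma>hat n \<omega>) (Mhat n \<omega>) (Mc n \<omega>)"
    using rank by (intro argmin_eventually) simp
  with Mc_tendsto[OF rank(1)] \<Gamma>star_prob Wstar_law AE_space show ?thesis
  proof eventually_elim
    case (elim \<omega>)
    note sec = bootstrap_section[OF \<open>\<omega> \<in> space P\<close>]
    have rank_Mc: "\<forall>\<^sub>F n in sequentially. rank (Mc n \<omega>) = rank M0"
      using elim(5) by eventually_elim (simp add: is_rank_argmin_def is_arg_min_def rank)
    have appr: "converges_in_prob (\<lambda>n. K n \<omega>) (\<lambda>n b. \<Lambda>star n \<omega> b - tangent_sq \<Gamma> M0 (Wstar n \<omega> b)) 0"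
      using scaled_min_rank_sq_in_prob[OF \<Gamma>_cov \<Gamma>_det sec(1-3) Q W_meas elim(3,2,1) rank_Mc N]
      by (simp add: \<Lambda>star_def rank)
    have "(\<lambda>n. cdf (distr (K n \<omega>) borel (\<Lambda>star n \<omega>)) x)
        \<longlonglongrightarrow> cdf (distr Q borel (\<lambda>x. tangent_sq \<Gamma> M0 (W x))) x" for x
      by (rule converges_in_law_cdf[OF sec(1,2,4) Q W_meas elim(3)
            continuous_on_tangent_sq[OF weighted_sq_nonneg[OF \<Gamma>_cov \<Gamma>_det]] appr
            isCont_cdf_tangent_sq_law[OF law]])
    then show ?case
      unfolding qhat_def using prob_space.real_distribution_distr[OF sec(1,4)]
      by (intro quantile_tendsto[where F = "cdf (distr Q borel (\<lambda>x. tangent_sq \<Gamma> M0 (W x)))"]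
          cdf_tangent_sq_law_strict_mono[OF law] q \<alpha>)
  qed
qed

text \<open>The random critical value is moved to the other side: rejection means that
  \<open>\<Lambda>hat n \<omega> - (qhat \<alpha> n \<omega> - q)\<close> exceeds the constant
  \<open>q\<close>. The correction vanishes in probability, and \<open>q\<close> is a continuity
  point of the limit law.\<close>

lemma rejection_prob_null:
  assumes rank: "rank M0 = m" "m < CARD('p)" and \<alpha>: "0 < \<alpha>" "\<alpha> < 1"
  shows "(\<lambda>n. measure P {\<omega> \<in> space P. \<Lambda>hat n \<omega> > qhat \<alpha> n \<omega>}) \<longlonglongrightarrow> 1 - \<alpha>"
proof -
  interpret prob_space P by (rule P)
  note [measurable] = qhat_measurable[OF \<alpha>]
  have ranks: "rank M0 < CARD('p)" "rank M0 < CARD('h)"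
    using rank pH by simp_all
  note law = \<Gamma>_cov \<Gamma>_det ranks Q W_meas W_normal
  note [measurable] = measurable_tangent_sq[OF law]
  obtain q where q: "0 < q" "cdf (distr Q borel (\<lambda>x. tangent_sq \<Gamma> M0 (W x))) q = \<alpha>"
    by (rule tangent_sq_law_quantileE[OF law \<alpha>])
  define X where "X n \<omega> = sqrt (real (N n)) *\<^sub>R (Mhat n \<omega> - M0)" for n \<omega>
  have X_meas [measurable]: "X n \<in> borel_measurable P" for n
    unfolding X_def[abs_def] by measurable
  have X_law: "converges_in_law (\<lambda>n. P) X Q W"
    using Mhat_law unfolding X_def[abs_def] .
  \<comment> \<open>For \<open>N n = 0\<close> both sides are 0; otherwise the two scalings
    cancel.\<close>
  have "\<Lambda>hat n \<omega> = real (N n) * min_rank_sq (rank M0) (\<Gamma>hat n \<omega>) (M0 + (1 / sqrt (real (N n))) *\<^sub>R X n \<omega>)" for n \<omega>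
    by (cases "N n = 0") (simp_all add: \<Lambda>hat_def X_def rank)
  then have "converges_in_prob (\<lambda>n. P) (\<lambda>n \<omega>. \<Lambda>hat n \<omega> - tangent_sq \<Gamma> M0 (X n \<omega>)) 0"
    using scaled_min_rank_sq_in_prob[OF \<Gamma>_cov \<Gamma>_det P X_meas \<Gamma>hat_meas Q W_meas X_law \<Gamma>hat_prob tendsto_const _ N]
    by simp
  moreover have "converges_in_prob (\<lambda>n. P) (\<lambda>n \<omega>. qhat \<alpha> n \<omega> - q) 0"
    using qhat_tendsto[OF rank \<alpha> q] by (intro converges_in_prob_AE P) (auto simp: LIM_zero_iff)
  ultimately have "converges_in_prob (\<lambda>n. P)
      (\<lambda>n \<omega>. (\<Lambda>hat n \<omega> - tangent_sq \<Gamma> M0 (X n \<omega>)) - (qhat \<alpha> n \<omega> - q)) (0 - 0)"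
    by (intro converges_in_prob_diff P) measurable
  then have appr: "converges_in_prob (\<lambda>n. P)
      (\<lambda>n \<omega>. (\<Lambda>hat n \<omega> - (qhat \<alpha> n \<omega> - q)) - tangent_sq \<Gamma> M0 (X n \<omega>)) 0"
    by (simp add: algebra_simps)
  have "(\<lambda>n. cdf (distr P borel (\<lambda>\<omega>. \<Lambda>hat n \<omega> - (qhat \<alpha> n \<omega> - q))) q)
      \<longlonglongrightarrow> cdf (distr Q borel (\<lambda>x. tangent_sq \<Gamma> M0 (W x))) q"
    by (rule converges_in_law_cdf[OF P X_meas _ Q W_meas X_law
          continuous_on_tangent_sq[OF weighted_sq_nonneg[OF \<Gamma>_cov \<Gamma>_det]] appr
          isCont_cdf_tangent_sq_law[OF law]]) measurable
  then have "(\<lambda>n. 1 - cdf (distr P borel (\<lambda>\<omega>. \<Lambda>hat n \<omega> - (qhat \<alpha> n \<omega> - q))) q) \<longlonglongrightarrow> 1 - \<alpha>"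
    unfolding q(2) by (intro tendsto_intros)
  moreover have "1 - cdf (distr P borel (\<lambda>\<omega>. \<Lambda>hat n \<omega> - (qhat \<alpha> n \<omega> - q))) q =
      measure P {\<omega> \<in> space P. \<Lambda>hat n \<omega> > qhat \<alpha> n \<omega>}" for n
  proof -
    have "cdf (distr P borel (\<lambda>\<omega>. \<Lambda>hat n \<omega> - (qhat \<alpha> n \<omega> - q))) q = prob {\<omega> \<in> space P. \<Lambda>hat n \<omega> \<le> qhat \<alpha> n \<omega>}"
      unfolding cdf_def2 by (subst measure_distr) (auto intro!: arg_cong[where f = prob])
    also have "\<dots> = 1 - prob (space P - {\<omega> \<in> space P. \<Lambda>hat n \<omega> \<le> qhat \<alpha> n \<omega>})"
      by (subst prob_compl) auto
    also have "space P - {\<omega> \<in> space P. \<Lambda>hat n \<omega> \<le> qhat \<alpha> n \<omega>} = {\<omega> \<in> space P. \<Lambda>hat n \<omega> > qhat \<alpha> n \<omega>}"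
      by auto
    finally show ?thesis by simp
  qed
  ultimately show ?thesis by simp
qed

text \<open>The set of matrices of rank at most \<open>m\<close> is closed and misses
  \<open>M0\<close>, hence stays at distance at least \<open>e\<close> from \<open>M0\<close> and
  eventually at least \<open>e / 2\<close> from \<open>Mhat\<close>; coercivity does the
  rest.\<close>

lemma \<Lambda>hat_lower_bound:
  assumes rank: "m < rank M0"
  obtains c where "0 < c" "AE \<omega> in P. \<forall>\<^sub>F n in sequentially. c * real (N n) \<le> \<Lambda>hat n \<omega>"
proof -
  obtain c C where c: "0 < c" "0 < C" and
    ev: "\<forall>\<^sub>F G in nhds \<Gamma>. \<forall>A. c * (norm A)\<^sup>2 \<le> weighted_sq G A \<and> weighted_sq G A \<le> C * (norm A)\<^sup>2"
    by (rule weighted_sq_bounds[OF \<Gamma>_cov \<Gamma>_det])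
  have "open (- {A :: real^'h^'p. rank A \<le> m})"
    by (intro open_Compl closed_rank_le)
  then obtain e where e: "0 < e" "ball M0 e \<subseteq> - {A :: real^'h^'p. rank A \<le> m}"
    using rank unfolding open_contains_ball by (metis ComplI mem_Collect_eq not_less)
  have "AE \<omega> in P. \<forall>\<^sub>F n in sequentially. is_rank_argmin m (\<Gamma>hat n \<omega>) (Mhat n \<omega>) (Mc n \<omega>)"
    using rank by (intro argmin_eventually) simp
  with Mhat_as \<Gamma>hat_as have "AE \<omega> in P. \<forall>\<^sub>F n in sequentially. c * (e / 2)\<^sup>2 * real (N n) \<le> \<Lambda>hat n \<omega>"
  proof eventually_elim
    case (elim \<omega>)
    show ?case
      using tendstoD[OF elim(1) half_gt_zero[OF e(1)]] elim(3) eventually_compose_filterlim[OF ev elim(2)]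
    proof eventually_elim
      case (elim n)
      have "c * (e / 2)\<^sup>2 \<le> min_rank_sq m (\<Gamma>hat n \<omega>) (Mhat n \<omega>)"
        unfolding min_rank_sq_def
      proof (rule cINF_greatest)
        \<comment> \<open>\<open>Mc\<close> itself witnesses that matrices of rank \<open>m\<close>
          exist; the infimum over an empty set would carry no information.\<close>
        show "{A :: real^'h^'p. rank A = m} \<noteq> {}"
          using elim(2) by (auto simp: is_rank_argmin_def is_arg_min_def)
        fix A :: "real^'h^'p" assume "A \<in> {A. rank A = m}"
        then have "e \<le> dist M0 A"
          using e(2) by (auto simp: not_less[symmetric])
        then have "e / 2 \<le> norm (Mhat n \<omega> - A)"
          using elim(1) dist_triangle[of M0 A "Mhat n \<omega>"] by (simp add: dist_norm norm_minus_commute)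
        then have "c * (e / 2)\<^sup>2 \<le> c * (norm (Mhat n \<omega> - A))\<^sup>2"
          using c(1) e(1) by (intro mult_left_mono power_mono) auto
        also have "\<dots> \<le> weighted_sq (\<Gamma>hat n \<omega>) (Mhat n \<omega> - A)"
          using elim(3) by blast
        finally show "c * (e / 2)\<^sup>2 \<le> weighted_sq (\<Gamma>hat n \<omega>) (Mhat n \<omega> - A)" .
      qed
      then show ?case
        unfolding \<Lambda>hat_def by (subst mult.commute) (rule mult_left_mono, simp_all)
    qed
  qed
  then show ?thesis
    by (rule that[rotated]) (use c e in simp)
qed

text \<open>Since \<open>Mc\<close> has rank \<open>m\<close>, it is admissible in the minimum defining \<open>\<Lambda>star\<close>, which is
  therefore at most \<open>weighted_sq \<Gamma>star Wstar\<close> whatever the rank of \<open>M0\<close>.\<close>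

lemma qhat_bounded:
  assumes rank: "m \<le> rank M0" and \<alpha>: "0 < \<alpha>" "\<alpha> < 1"
  shows "AE \<omega> in P. \<exists>q. \<forall>\<^sub>F n in sequentially. qhat \<alpha> n \<omega> \<le> q"
proof -
  obtain c C where c: "0 < c" "0 < C" and
    ev: "\<forall>\<^sub>F G in nhds \<Gamma>. \<forall>A. c * (norm A)\<^sup>2 \<le> weighted_sq G A \<and> weighted_sq G A \<le> C * (norm A)\<^sup>2"
    by (rule weighted_sq_bounds[OF \<Gamma>_cov \<Gamma>_det])
  then obtain d where d: "0 < d" "\<And>G A. dist G \<Gamma> < d \<Longrightarrow> c * (norm A)\<^sup>2 \<le> weighted_sq G A \<and> weighted_sq G A \<le> C * (norm A)\<^sup>2"
    unfolding eventually_nhds_metric by blast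
  \<comment> \<open>Two exceptional events, a large \<open>Wstar\<close> and a
    \<open>\<Gamma>star\<close> far from \<open>\<Gamma>\<close>, share the admissible probability
    \<open>1 - \<alpha>\<close>.\<close>
  have \<alpha>': "0 < (1 - \<alpha>) / 2" using \<alpha> by simp
  show ?thesis
    using argmin_eventually[OF rank] \<Gamma>star_prob Wstar_law AE_space
  proof eventually_elim
    case (elim \<omega>)
    note sec = bootstrap_section[OF \<open>\<omega> \<in> space P\<close>]
    obtain R where R: "\<forall>\<^sub>F n in sequentially. measure (K n \<omega>) {b \<in> space (K n \<omega>). R < norm (Wstar n \<omega> b)} < (1 - \<alpha>) / 2"
      by (rule converges_in_law_tight[OF sec(1,2) Q W_meas elim(3) \<alpha>'])
    have 1: "\<forall>\<^sub>F n in sequentially. measure (K n \<omega>) {b \<in> space (K n \<omega>). d / 2 < dist (\<Gamma>star n \<omega> b) \<Gamma>} < (1 - \<alpha>) / 2"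
      using elim(2)[unfolded converges_in_prob_def, rule_format, OF half_gt_zero[OF d(1)]] \<alpha>'
      by (rule order_tendstoD)
    have 2: "\<forall>\<^sub>F n in sequentially. 0 < N n"
      using filterlim_at_top[THEN iffD1, OF N, rule_format, of 1] by eventually_elim simp
    have "\<forall>\<^sub>F n in sequentially. qhat \<alpha> n \<omega> \<le> C * R\<^sup>2"
      using elim(1) R 1 2
    proof eventually_elim
      case (elim n)
      interpret K: prob_space "K n \<omega>" by (rule sec)
      note [measurable] = sec(2-4)[of n]
      interpret D: real_distribution "distr (K n \<omega>) borel (\<Lambda>star n \<omega>)"
        by (intro K.real_distribution_distr) measurable
      have le: "\<Lambda>star n \<omega> b \<le> C * R\<^sup>2" if b: "norm (Wstar n \<omega> b) \<le> R" "dist (\<Gamma>star n \<omega> b) \<Gamma> \<le> d / 2" for b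
      proof -
        have G: "dist (\<Gamma>star n \<omega> b) \<Gamma> < d" using b(2) d(1) by simp
        have "min_rank_sq m (\<Gamma>star n \<omega> b) (Mc n \<omega> + (1 / sqrt (real (N n))) *\<^sub>R Wstar n \<omega> b) \<le>
            weighted_sq (\<Gamma>star n \<omega> b) (Mc n \<omega> + (1 / sqrt (real (N n))) *\<^sub>R Wstar n \<omega> b - Mc n \<omega>)"
          using elim(1) d(2)[OF G] c(1)
          by (intro min_rank_sq_le coercive_nonneg[of c]) (auto simp: is_rank_argmin_def is_arg_min_def)
        also have "\<dots> = weighted_sq (\<Gamma>star n \<omega> b) (Wstar n \<omega> b) / real (N n)"
          by (simp add: weighted_sq_scaleR power_divide)
        finally have "\<Lambda>star n \<omega> b \<le> weighted_sq (\<Gamma>star n \<omega> b) (Wstar n \<omega> b)"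
          using elim(4) by (simp add: \<Lambda>star_def field_simps)
        also have "\<dots> \<le> C * (norm (Wstar n \<omega> b))\<^sup>2"
          using d(2)[OF G] by blast
        also have "\<dots> \<le> C * R\<^sup>2"
          using b(1) c(2) by (intro mult_left_mono power_mono) auto
        finally show ?thesis .
      qed
      let ?S = "{b \<in> space (K n \<omega>). \<Lambda>star n \<omega> b \<le> C * R\<^sup>2}"
      have "1 - K.prob ?S = K.prob (space (K n \<omega>) - ?S)"
        by (subst K.prob_compl) auto
      also have "\<dots> \<le> K.prob ({b \<in> space (K n \<omega>). R < norm (Wstar n \<omega> b)} \<union>
          {b \<in> space (K n \<omega>). d / 2 < dist (\<Gamma>star n \<omega> b) \<Gamma>})"
        by (rule K.finite_measure_mono) (use le in \<open>force simp: not_le[symmetric]\<close>, measurable)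
      also have "\<dots> \<le> K.prob {b \<in> space (K n \<omega>). R < norm (Wstar n \<omega> b)} +
          K.prob {b \<in> space (K n \<omega>). d / 2 < dist (\<Gamma>star n \<omega> b) \<Gamma>}"
        by (rule measure_Un_le) measurable
      also have "\<dots> < 1 - \<alpha>" using elim(2,3) by simp
      finally have "\<alpha> \<le> K.prob ?S" by simp
      also have "\<dots> = cdf (distr (K n \<omega>) borel (\<Lambda>star n \<omega>)) (C * R\<^sup>2)"
        unfolding cdf_def2 by (subst measure_distr) (auto intro!: arg_cong[where f = K.prob])
      finally show ?case
        unfolding qhat_def using D.quantile_le_iff[OF \<alpha>] by simp
    qed
    then show ?case by blast
  qed
qed

text \<open>The bound on \<open>qhat\<close> depends on the sample point. Almost sure eventual
  rejection is nevertheless enough, by dominated convergence of the indicators.\<close>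

lemma rejection_prob_alternative:
  assumes rank: "m < rank M0" and \<alpha>: "0 < \<alpha>" "\<alpha> < 1"
  shows "(\<lambda>n. measure P {\<omega> \<in> space P. \<Lambda>hat n \<omega> > qhat \<alpha> n \<omega>}) \<longlonglongrightarrow> 1"
proof -
  interpret prob_space P by (rule P)
  note [measurable] = qhat_measurable[OF \<alpha>]
  obtain c where c: "0 < c" "AE \<omega> in P. \<forall>\<^sub>F n in sequentially. c * real (N n) \<le> \<Lambda>hat n \<omega>"
    by (rule \<Lambda>hat_lower_bound[OF rank])
  have "filterlim (\<lambda>n. c * real (N n)) at_top sequentially"
    by (intro filterlim_tendsto_pos_mult_at_top[OF tendsto_const c(1)]
        filterlim_compose[OF filterlim_real_sequentially N])
  then have large: "\<forall>\<^sub>F n in sequentially. q < c * real (N n)" for q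
    by (simp add: filterlim_at_top_dense)
  have "(\<lambda>n. prob {\<omega> \<in> space P. \<Lambda>hat n \<omega> \<le> qhat \<alpha> n \<omega>}) \<longlonglongrightarrow> 0"
  proof (rule measure_tendsto_0_AE[OF P])
    have "AE \<omega> in P. \<exists>q. \<forall>\<^sub>F n in sequentially. qhat \<alpha> n \<omega> \<le> q"
      using rank \<alpha> by (intro qhat_bounded) auto
    with c(2) show "AE \<omega> in P. \<forall>\<^sub>F n in sequentially. \<omega> \<notin> {\<omega> \<in> space P. \<Lambda>hat n \<omega> \<le> qhat \<alpha> n \<omega>}"
    proof eventually_elim
      case (elim \<omega>)
      then obtain q where "\<forall>\<^sub>F n in sequentially. qhat \<alpha> n \<omega> \<le> q" by blast
      with elim(1) large[of q] show ?case
        by eventually_elim auto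
    qed
  qed measurable
  then have "(\<lambda>n. 1 - prob {\<omega> \<in> space P. \<Lambda>hat n \<omega> \<le> qhat \<alpha> n \<omega>}) \<longlonglongrightarrow> 1 - 0"
    by (intro tendsto_intros)
  moreover have "1 - prob {\<omega> \<in> space P. \<Lambda>hat n \<omega> \<le> qhat \<alpha> n \<omega>} = prob {\<omega> \<in> space P. \<Lambda>hat n \<omega> > qhat \<alpha> n \<omega>}" for n
    by (subst prob_compl[symmetric]) (auto intro!: arg_cong[where f = prob])
  ultimately show ?thesis by simp
qed

end

section \<open>Passage to subsequences and the theorem\<close>

lemma tendsto_subsubsequence:
  fixes f :: "nat \<Rightarrow> 'a::topological_space"
  assumes "\<And>r :: nat \<Rightarrow> nat. strict_mono r \<Longrightarrow> \<exists>s :: nat \<Rightarrow> nat. strict_mono s \<and> (\<lambda>n. f (r (s n))) \<longlonglongrightarrow> L"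
  shows "f \<longlonglongrightarrow> L"
proof (rule topological_tendstoI, rule ccontr)
  fix S assume S: "open S" "L \<in> S" and "\<not> (\<forall>\<^sub>F n in sequentially. f n \<in> S)"
  from not_eventually_sequentiallyD[OF this(3)] obtain r :: "nat \<Rightarrow> nat"
    where r: "strict_mono r" "\<And>n. f (r n) \<notin> S" by blast
  obtain s :: "nat \<Rightarrow> nat" where "(\<lambda>n. f (r (s n))) \<longlonglongrightarrow> L"
    using assms[OF r(1)] by blast
  from topological_tendstoD[OF this S] have "\<forall>\<^sub>F n in sequentially. False"
    using r(2) by simp
  then show False by simp
qed

lemma converges_in_law_subseq:
  "converges_in_law P X Q W \<Longrightarrow> strict_mono r \<Longrightarrow> converges_in_law (\<lambda>n. P (r n)) (\<lambda>n. X (r n)) Q W"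
  unfolding converges_in_law_def using LIMSEQ_subseq_LIMSEQ[of _ _ r] by (fastforce simp: o_def)

lemma converges_in_prob_subseq:
  "converges_in_prob P X c \<Longrightarrow> strict_mono r \<Longrightarrow> converges_in_prob (\<lambda>n. P (r n)) (\<lambda>n. X (r n)) c"
  unfolding converges_in_prob_def using LIMSEQ_subseq_LIMSEQ[of _ _ r] by (fastforce simp: o_def)

(* P is the law of the sample. For a sample point \<omega>, K n \<omega> is the conditional law, given the sample,
   of the bootstrap randomness at sample size n, so that a starred quantity is a function of the
   sample and of the bootstrap outcome b. In the degenerate case m = CARD('p) both statistics vanish
   under H0 (rank-m matrices are dense), hence so do the quantile and the rejection probability; the
   limit 1 - \<alpha> is therefore claimed for m < CARD('p). *)
theorem proposition11:
  fixes M0 :: "real^'h^'p"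
    and m :: nat
    and \<Gamma> :: "real^('h \<times> 'p)^('h \<times> 'p)"
    and P :: "'w measure"
    and Mhat Mc :: "nat \<Rightarrow> 'w \<Rightarrow> real^'h^'p"
    and \<Gamma>hat :: "nat \<Rightarrow> 'w \<Rightarrow> real^('h \<times> 'p)^('h \<times> 'p)"
    and Q :: "'c measure"
    and W :: "'c \<Rightarrow> real^'h^'p"
    and B :: "nat \<Rightarrow> 'b measure"
    and K :: "nat \<Rightarrow> 'w \<Rightarrow> 'b measure"
    and Wstar Mstar :: "nat \<Rightarrow> 'w \<Rightarrow> 'b \<Rightarrow> real^'h^'p"
    and \<Gamma>star :: "nat \<Rightarrow> 'w \<Rightarrow> 'b \<Rightarrow> real^('h \<times> 'p)^('h \<times> 'p)"
    and \<Lambda>hat :: "nat \<Rightarrow> 'w \<Rightarrow> real"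
    and \<Lambda>star :: "nat \<Rightarrow> 'w \<Rightarrow> 'b \<Rightarrow> real"
    and qhat :: "real \<Rightarrow> nat \<Rightarrow> 'w \<Rightarrow> real"
  assumes pH: "CARD('p) \<le> CARD('h)"
    and m: "m \<in> {1..CARD('p)}"
    and P: "prob_space P"
    and Mhat_meas: "\<And>n. Mhat n \<in> borel_measurable P"
    and \<Gamma>hat_meas: "\<And>n. \<Gamma>hat n \<in> borel_measurable P"
    and Mc_meas: "\<And>n. Mc n \<in> borel_measurable P"
    and K: "\<And>n. K n \<in> measurable P (prob_algebra (B n))"
    and Wstar_meas: "\<And>n. (\<lambda>(\<omega>, b). Wstar n \<omega> b) \<in> borel_measurable (P \<Otimes>\<^sub>M B n)"
    and \<Gamma>star_meas: "\<And>n. (\<lambda>(\<omega>, b). \<Gamma>star n \<omega> b) \<in> borel_measurable (P \<Otimes>\<^sub>M B n)"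
    and \<Gamma>_cov: "covariance_matrix \<Gamma>"
    and \<Gamma>_full_rank: "rank \<Gamma> = CARD('h \<times> 'p)"
    and Q: "prob_space Q"
    and W_meas: "W \<in> borel_measurable Q"
    and W_normal: "distributed Q lborel (\<lambda>x. vectorize (W x)) (\<lambda>v. ennreal (mvn_density 0 \<Gamma> v))"
    and Mhat_law: "converges_in_law (\<lambda>n. P) (\<lambda>n \<omega>. sqrt (real n) *\<^sub>R (Mhat n \<omega> - M0)) Q W"
    and Mhat_as: "AE \<omega> in P. (\<lambda>n. Mhat n \<omega>) \<longlonglongrightarrow> M0"
    and \<Gamma>hat_prob: "converges_in_prob (\<lambda>n. P) \<Gamma>hat \<Gamma>"
    and \<Gamma>star_prob: "AE \<omega> in P. converges_in_prob (\<lambda>n. K n \<omega>) (\<lambda>n. \<Gamma>star n \<omega>) \<Gamma>"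
    and Mc_argmin: "\<And>n \<omega>. \<omega> \<in> space P \<Longrightarrow> \<exists>A. is_rank_argmin m (\<Gamma>hat n \<omega>) (Mhat n \<omega>) A
                       \<Longrightarrow> is_rank_argmin m (\<Gamma>hat n \<omega>) (Mhat n \<omega>) (Mc n \<omega>)"
    and Wstar_law: "AE \<omega> in P. converges_in_law (\<lambda>n. K n \<omega>) (\<lambda>n. Wstar n \<omega>) Q W"
    and Mstar_eq: "\<And>n \<omega> b. Mstar n \<omega> b = Mc n \<omega> + (1 / sqrt (real n)) *\<^sub>R Wstar n \<omega> b"
    and \<Lambda>hat_eq: "\<And>n \<omega>. \<Lambda>hat n \<omega> = real n * min_rank_sq m (\<Gamma>hat n \<omega>) (Mhat n \<omega>)"
    and \<Lambda>star_eq: "\<And>n \<omega> b. \<Lambda>star n \<omega> b = real n * min_rank_sq m (\<Gamma>star n \<omega> b) (Mstar n \<omega> b)"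
    and qhat_eq: "\<And>\<alpha> n \<omega>. qhat \<alpha> n \<omega> = quantile (distr (K n \<omega>) borel (\<Lambda>star n \<omega>)) \<alpha>"
  shows "\<forall>\<alpha>\<in>{0<..<1}.
      (rank M0 = m \<and> m < CARD('p) \<longrightarrow>
         (\<lambda>n. measure P {\<omega> \<in> space P. \<Lambda>hat n \<omega> > qhat \<alpha> n \<omega>}) \<longlonglongrightarrow> 1 - \<alpha>) \<and>
      (rank M0 > m \<longrightarrow>
         (\<lambda>n. measure P {\<omega> \<in> space P. \<Lambda>hat n \<omega> > qhat \<alpha> n \<omega>}) \<longlonglongrightarrow> 1)"
proof (intro ballI conjI impI)
  fix \<alpha> :: real assume "\<alpha> \<in> {0<..<1}"
  then have \<alpha>: "0 < \<alpha>" "\<alpha> < 1" by simp_all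
  have det: "det \<Gamma> \<noteq> 0"
    using \<Gamma>_full_rank det_eq_0_rank[of \<Gamma>] by simp
  \<comment> \<open>Along an arbitrary subsequence \<open>r\<close>, a further thinning
    \<open>s\<close> makes \<open>\<Gamma>hat\<close> converge almost surely; the other convergences
    survive thinning. The sample sizes are then \<open>r (s n)\<close>, which is why the locale
    carries the sequence \<open>N\<close>.\<close>
  have subseq: "\<exists>s :: nat \<Rightarrow> nat. strict_mono s \<and>
      rank_bootstrap M0 m \<Gamma> P (\<lambda>n. Mhat (r (s n))) (\<lambda>n. Mc (r (s n))) (\<lambda>n. \<Gamma>hat (r (s n))) Q W
        (\<lambda>n. B (r (s n))) (\<lambda>n. K (r (s n))) (\<lambda>n. Wstar (r (s n))) (\<lambda>n. \<Gamma>star (r (s n))) (\<lambda>n. r (s n))"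
    if r: "strict_mono r" for r :: "nat \<Rightarrow> nat"
  proof -
    obtain s :: "nat \<Rightarrow> nat" where s: "strict_mono s" "AE \<omega> in P. (\<lambda>n. \<Gamma>hat (r (s n)) \<omega>) \<longlonglongrightarrow> \<Gamma>"
      using converges_in_prob_AE_subseq[OF P \<Gamma>hat_meas converges_in_prob_subseq[OF \<Gamma>hat_prob r]] by blast
    have rs: "strict_mono (\<lambda>n. r (s n))"
      using strict_mono_o[OF r s(1)] by (simp add: o_def)
    have "AE \<omega> in P. (\<lambda>n. Mhat (r (s n)) \<omega>) \<longlonglongrightarrow> M0"
      using Mhat_as by eventually_elim (use LIMSEQ_subseq_LIMSEQ[OF _ rs] in \<open>auto simp: o_def\<close>)
    moreover have "AE \<omega> in P. converges_in_prob (\<lambda>n. K (r (s n)) \<omega>) (\<lambda>n. \<Gamma>star (r (s n)) \<omega>) \<Gamma>"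
      using \<Gamma>star_prob by eventually_elim (rule converges_in_prob_subseq[OF _ rs])
    moreover have "AE \<omega> in P. converges_in_law (\<lambda>n. K (r (s n)) \<omega>) (\<lambda>n. Wstar (r (s n)) \<omega>) Q W"
      using Wstar_law by eventually_elim (rule converges_in_law_subseq[OF _ rs])
    moreover have "converges_in_law (\<lambda>n. P) (\<lambda>n \<omega>. sqrt (real (r (s n))) *\<^sub>R (Mhat (r (s n)) \<omega> - M0)) Q W"
      using converges_in_law_subseq[OF Mhat_law rs] .
    moreover have "converges_in_prob (\<lambda>n. P) (\<lambda>n. \<Gamma>hat (r (s n))) \<Gamma>"
      using converges_in_prob_subseq[OF \<Gamma>hat_prob rs] .
    ultimately have "rank_bootstrap M0 m \<Gamma> P (\<lambda>n. Mhat (r (s n))) (\<lambda>n. Mc (r (s n))) (\<lambda>n. \<Gamma>hat (r (s n))) Q W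
        (\<lambda>n. B (r (s n))) (\<lambda>n. K (r (s n))) (\<lambda>n. Wstar (r (s n))) (\<lambda>n. \<Gamma>star (r (s n))) (\<lambda>n. r (s n))"
      by (intro rank_bootstrap.intro)
        (use pH P Mhat_meas \<Gamma>hat_meas Mc_meas K Wstar_meas \<Gamma>star_meas \<Gamma>_cov det Q W_meas W_normal Mc_argmin
          s(2) filterlim_subseq[OF rs] in \<open>simp_all\<close>)
    with s(1) show ?thesis by blast
  qed
  \<comment> \<open>The locale builds its statistics from the thinned sequences with sample sizes
    \<open>k\<close>; unfolding identifies them with the original statistics at index
    \<open>k n\<close>.\<close>
  have stats: "\<Lambda>hat (k n) \<omega> = rank_bootstrap.\<Lambda>hat m (\<lambda>n. Mhat (k n)) (\<lambda>n. \<Gamma>hat (k n)) k n \<omega>"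
    "qhat \<alpha> (k n) \<omega> = rank_bootstrap.qhat m (\<lambda>n. Mc (k n)) (\<lambda>n. K (k n)) (\<lambda>n. Wstar (k n)) (\<lambda>n. \<Gamma>star (k n)) k \<alpha> n \<omega>"
    if "rank_bootstrap M0 m \<Gamma> P (\<lambda>n. Mhat (k n)) (\<lambda>n. Mc (k n)) (\<lambda>n. \<Gamma>hat (k n)) Q W
        (\<lambda>n. B (k n)) (\<lambda>n. K (k n)) (\<lambda>n. Wstar (k n)) (\<lambda>n. \<Gamma>star (k n)) k" for k n \<omega>
    by (simp_all add: rank_bootstrap.\<Lambda>hat_def[OF that] rank_bootstrap.qhat_def[OF that]
        rank_bootstrap.\<Lambda>star_def[OF that, abs_def] \<Lambda>hat_eq qhat_eq \<Lambda>star_eq[abs_def] Mstar_eq)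
  show "(\<lambda>n. measure P {\<omega> \<in> space P. \<Lambda>hat n \<omega> > qhat \<alpha> n \<omega>}) \<longlonglongrightarrow> 1 - \<alpha>"
    if "rank M0 = m \<and> m < CARD('p)"
  proof (rule tendsto_subsubsequence)
    fix r :: "nat \<Rightarrow> nat" assume "strict_mono r"
    from subseq[OF this] obtain s :: "nat \<Rightarrow> nat" where s: "strict_mono s" and
      loc: "rank_bootstrap M0 m \<Gamma> P (\<lambda>n. Mhat (r (s n))) (\<lambda>n. Mc (r (s n))) (\<lambda>n. \<Gamma>hat (r (s n))) Q W
        (\<lambda>n. B (r (s n))) (\<lambda>n. K (r (s n))) (\<lambda>n. Wstar (r (s n))) (\<lambda>n. \<Gamma>star (r (s n))) (\<lambda>n. r (s n))"
      by blast
    then show "\<exists>s :: nat \<Rightarrow> nat. strict_mono s \<and>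
        (\<lambda>n. measure P {\<omega> \<in> space P. \<Lambda>hat (r (s n)) \<omega> > qhat \<alpha> (r (s n)) \<omega>}) \<longlonglongrightarrow> 1 - \<alpha>"
      using rank_bootstrap.rejection_prob_null[OF loc] that \<alpha> by (auto simp: stats[OF loc])
  qed
  show "(\<lambda>n. measure P {\<omega> \<in> space P. \<Lambda>hat n \<omega> > qhat \<alpha> n \<omega>}) \<longlonglongrightarrow> 1"
    if "rank M0 > m"
  proof (rule tendsto_subsubsequence)
    fix r :: "nat \<Rightarrow> nat" assume "strict_mono r"
    from subseq[OF this] obtain s :: "nat \<Rightarrow> nat" where s: "strict_mono s" and
      loc: "rank_bootstrap M0 m \<Gamma> P (\<lambda>n. Mhat (r (s n))) (\<lambda>n. Mc (r (s n))) (\<lambda>n. \<Gamma>hat (r (s n))) Q W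
        (\<lambda>n. B (r (s n))) (\<lambda>n. K (r (s n))) (\<lambda>n. Wstar (r (s n))) (\<lambda>n. \<Gamma>star (r (s n))) (\<lambda>n. r (s n))"
      by blast
    then show "\<exists>s :: nat \<Rightarrow> nat. strict_mono s \<and>
        (\<lambda>n. measure P {\<omega> \<in> space P. \<Lambda>hat (r (s n)) \<omega> > qhat \<alpha> (r (s n)) \<omega>}) \<longlonglongrightarrow> 1"
      using rank_bootstrap.rejection_prob_alternative[OF loc] that \<alpha> by (auto simp: stats[OF loc])
  qed
qed

end
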